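(* Let $N\geq 10$, let $B_1$ be the open unit ball of $\mathbb{R}^N$, and let $f:[0,\infty)\to\mathbb{R}$ be $C^1$, nondecreasing and convex with $f(0)>0$ and $\lim_{t\to+\infty} f(t)/t=+\infty$. Let $\lambda^\ast$ and $u^\ast$ be the extremal parameter and the extremal solution of the problem $-\Delta u=\lambda f(u)$ in $B_1$, $u>0$ in $B_1$, $u=0$ on $\partial B_1$. Suppose that $u^\ast$ is unbounded. Then $\limsup_{r\to 0} r^2 f'(u^\ast(r))\in(0,\infty)$. Moreover $$\frac{2(N-2)}{\lambda^\ast}\leq \limsup_{r\to 0} r^2 f'(u^\ast(r))\leq \frac{\lambda_1}{\lambda^\ast},$$ where $\lambda_1$ denotes the first eigenvalue of the linear problem $-\Delta v=\lambda v$ in $B_1\subset\mathbb{R}^N$ with Dirichlet conditions $v=0$ on $\partial B_1$.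
   Context: For $f:[0,\infty)\to\mathbb{R}$ which is $C^1$, nondecreasing and convex with $f(0)>0$ and $\lim_{t\to+\infty}f(t)/t=+\infty$, consider for $\lambda\ge 0$ the problem $(P_\lambda)$: $-\Delta u=\lambda f(u)$ in $B_1$, $u>0$ in $B_1$, $u=0$ on $\partial B_1$. It is well known that there is a finite number $\lambda^\ast>0$ (the extremal parameter) such that for $0<\lambda<\lambda^\ast$ the problem $(P_\lambda)$ has a minimal (i.e. pointwise smallest) classical solution $u_\lambda\in C^0(\overline{B_1})\cap C^2(B_1)$, while for $\lambda>\lambda^\ast$ there is no solution, even in the weak sense. The functions $u_\lambda$ are increasing in $\lambda$, and the extremal solution is the pointwise limit $u^\ast(x):=\lim_{\lambda\uparrow\lambda^\ast}u_\lambda(x)$, a weak solution of $(P_{\lambda^\ast})$. On the ball, $u^\ast$ is radially symmetric and radially decreasing; $u^\ast(r)$ denotes its value at points with $|x|=r$. *)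

theory Defs
  imports "HOL-Analysis.Analysis"
begin

definition partial :: "'a::euclidean_space \<Rightarrow> ('a \<Rightarrow> real) \<Rightarrow> 'a \<Rightarrow> real" where
  "partial b u x = frechet_derivative u (at x) b"

text \<open>The class \<open>C\<^sup>2(S)\<close>; only meant for open \<open>S\<close>.\<close>

definition C2_on :: "'a::euclidean_space set \<Rightarrow> ('a \<Rightarrow> real) \<Rightarrow> bool" where
  "C2_on S u \<longleftrightarrow>
     (\<forall>x\<in>S. u differentiable (at x)) \<and>
     (\<forall>b\<in>Basis. \<forall>x\<in>S. partial b u differentiable (at x)) \<and>
     (\<forall>b\<in>Basis. \<forall>c\<in>Basis. continuous_on S (partial c (partial b u)))"

definition laplacian :: "('a::euclidean_space \<Rightarrow> real) \<Rightarrow> 'a \<Rightarrow> real" where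
  "laplacian u x = (\<Sum>b\<in>Basis. partial b (partial b u) x)"

text \<open>Throughout, \<open>\<Omega>\<close> is a bounded open set with smooth boundary and the nonlinearity \<open>f\<close> is
  only relevant on \<open>[0, \<infinity>)\<close>. Values of solutions outside \<open>closure \<Omega>\<close> are irrelevant.\<close>

definition classical_solution ::
    "'a::euclidean_space set \<Rightarrow> (real \<Rightarrow> real) \<Rightarrow> real \<Rightarrow> ('a \<Rightarrow> real) \<Rightarrow> bool" where
  "classical_solution \<Omega> f lam u \<longleftrightarrow>
     continuous_on (closure \<Omega>) u \<and> C2_on \<Omega> u \<and>
     (\<forall>x\<in>\<Omega>. - laplacian u x = lam * f (u x)) \<and>
     (\<forall>x\<in>\<Omega>. u x > 0) \<and>
     (\<forall>x\<in>frontier \<Omega>. u x = 0)"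

definition minimal_solution ::
    "'a::euclidean_space set \<Rightarrow> (real \<Rightarrow> real) \<Rightarrow> real \<Rightarrow> ('a \<Rightarrow> real) \<Rightarrow> bool" where
  "minimal_solution \<Omega> f lam u \<longleftrightarrow>
     classical_solution \<Omega> f lam u \<and>
     (\<forall>v. classical_solution \<Omega> f lam v \<longrightarrow> (\<forall>x\<in>\<Omega>. u x \<le> v x))"

text \<open>Weak (very weak, \<open>L\<^sup>1\<close>) solutions in the sense of Brezis, Cazenave, Martel and Ramiandrisoa:
  \<open>u \<in> L\<^sup>1(\<Omega>)\<close>, \<open>u \<ge> 0\<close>, \<open>f(u) dist(\<cdot>, \<partial>\<Omega>) \<in> L\<^sup>1(\<Omega>)\<close>, tested against all
  \<open>\<phi> \<in> C\<^sup>2(closure \<Omega>)\<close> vanishing on \<open>\<partial>\<Omega>\<close>. The class \<open>C\<^sup>2(closure \<Omega>)\<close> is rendered as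
  \<open>C\<^sup>2\<close> on an open neighbourhood of \<open>closure \<Omega>\<close>.\<close>

definition weak_solution ::
    "'a::euclidean_space set \<Rightarrow> (real \<Rightarrow> real) \<Rightarrow> real \<Rightarrow> ('a \<Rightarrow> real) \<Rightarrow> bool" where
  "weak_solution \<Omega> f lam u \<longleftrightarrow>
     set_integrable lebesgue \<Omega> u \<and>
     (AE x in lebesgue. x \<in> \<Omega> \<longrightarrow> u x \<ge> 0) \<and>
     set_integrable lebesgue \<Omega> (\<lambda>x. f (u x) * infdist x (frontier \<Omega>)) \<and>
     (\<forall>\<phi>. (\<exists>S. open S \<and> closure \<Omega> \<subseteq> S \<and> C2_on S \<phi>) \<and> (\<forall>x\<in>frontier \<Omega>. \<phi> x = 0) \<longrightarrow>
        (LINT x:\<Omega>|lebesgue. u x * - laplacian \<phi> x) = lam * (LINT x:\<Omega>|lebesgue. f (u x) * \<phi> x))"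

text \<open>There is at most one such \<open>lams\<close>.\<close>

definition extremal_parameter ::
    "'a::euclidean_space set \<Rightarrow> (real \<Rightarrow> real) \<Rightarrow> real \<Rightarrow> bool" where
  "extremal_parameter \<Omega> f lams \<longleftrightarrow>
     lams > 0 \<and>
     (\<forall>lam. 0 < lam \<and> lam < lams \<longrightarrow> (\<exists>u. minimal_solution \<Omega> f lam u)) \<and>
     (\<forall>lam>lams. \<not> (\<exists>u. classical_solution \<Omega> f lam u) \<and> \<not> (\<exists>u. weak_solution \<Omega> f lam u))"

text \<open>The pointwise limit is taken in the extended reals, since an unbounded extremal solution
  on the ball is infinite at the origin.\<close>

definition extremal_solution ::
    "'a::euclidean_space set \<Rightarrow> (real \<Rightarrow> real) \<Rightarrow> real \<Rightarrow> ('a \<Rightarrow> ereal) \<Rightarrow> bool" where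
  "extremal_solution \<Omega> f lams us \<longleftrightarrow>
     (\<exists>U. (\<forall>lam. 0 < lam \<and> lam < lams \<longrightarrow> minimal_solution \<Omega> f lam (U lam)) \<and>
          (\<forall>x\<in>\<Omega>. ((\<lambda>lam. ereal (U lam x)) \<longlongrightarrow> us x) (at_left lams)))"

text \<open>The value \<open>u(r)\<close> of a radially symmetric function at the points with \<open>|x| = r\<close>.\<close>

definition radial_value :: "('a::euclidean_space \<Rightarrow> 'b) \<Rightarrow> real \<Rightarrow> 'b" where
  "radial_value u r = (THE s. \<forall>x. norm x = r \<longrightarrow> u x = s)"

definition dirichlet_eigenvalue :: "'a::euclidean_space set \<Rightarrow> real \<Rightarrow> bool" where
  "dirichlet_eigenvalue \<Omega> \<mu> \<longleftrightarrow>
     (\<exists>v. continuous_on (closure \<Omega>) v \<and> C2_on \<Omega> v \<and>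
          (\<forall>x\<in>\<Omega>. - laplacian v x = \<mu> * v x) \<and>
          (\<forall>x\<in>frontier \<Omega>. v x = 0) \<and>
          (\<exists>x\<in>\<Omega>. v x \<noteq> 0))"

definition first_dirichlet_eigenvalue :: "'a::euclidean_space set \<Rightarrow> real \<Rightarrow> bool" where
  "first_dirichlet_eigenvalue \<Omega> \<mu> \<longleftrightarrow>
     dirichlet_eigenvalue \<Omega> \<mu> \<and> (\<forall>\<nu>. dirichlet_eigenvalue \<Omega> \<nu> \<longrightarrow> \<mu> \<le> \<nu>)"

end

theory Submission
  imports Defs
begin

text \<open>Everything is proved for the minimal solutions \<open>u\<^sub>\<lambda>\<close> with \<open>\<lambda> < \<lambda>\<^sup>*\<close>, which are smooth and radial, and
  uniformly in \<open>\<lambda>\<close>; the estimates then pass to the limit \<open>u\<^sup>*\<close>. For \<open>\<lambda> < \<mu> < \<lambda>\<^sup>*\<close>, the difference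
  \<open>h = u\<^sub>\<mu> - u\<^sub>\<lambda>\<close> is positive and satisfies \<open>-\<Delta>h > \<lambda> f'(u\<^sub>\<lambda>) h\<close> by convexity. Since \<open>f'(u\<^sub>\<lambda>)\<close> is radially
  decreasing, comparing \<open>h\<close> on the ball of radius \<open>r\<close> with a rescaled Dirichlet eigenfunction gives
  \<open>r\<^sup>2 \<lambda> f'(u\<^sub>\<lambda>(r)) \<le> \<lambda>\<^sub>1\<close>. Conversely, if the upper limit were smaller than \<open>2(N-2)/\<lambda>\<^sup>*\<close>, the linear equation
  satisfied by \<open>w = -u\<^sub>\<lambda>'\<close> could be compared with \<open>r\<^sup>-\<^sup>\<alpha>\<close> for some \<open>\<alpha> < 1\<close> on a fixed interval \<open>(0, R]\<close>, so
  that \<open>w \<le> C r\<^sup>-\<^sup>\<alpha>\<close> with \<open>C\<close> independent of \<open>\<lambda>\<close>, and integration would make \<open>u\<^sup>*\<close> bounded. Monotonicity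
  in \<open>\<lambda>\<close> comes from a fixed point of the radial integral operator below \<open>u\<^sub>\<mu>\<close>.\<close>

section \<open>Second-order calculus\<close>

lemma partial_eq:
  assumes "(u has_derivative D) (at x)"
  shows "partial b u x = D b"
  unfolding partial_def using frechet_derivative_at[OF assms] by simp

lemma differentiable_partials:
  fixes u :: "'a::euclidean_space \<Rightarrow> real"
  assumes "u differentiable (at x)"
  shows "(u has_derivative (\<lambda>h. \<Sum>c\<in>Basis. (h \<bullet> c) * partial c u x)) (at x)"
proof -
  have d: "(u has_derivative frechet_derivative u (at x)) (at x)"
    using assms frechet_derivative_works by blast
  have "frechet_derivative u (at x) h = (\<Sum>c\<in>Basis. (h \<bullet> c) * partial c u x)" for h
  proof -
    have lin: "linear (frechet_derivative u (at x))"
      using d has_derivative_linear by blast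
    have "frechet_derivative u (at x) h = frechet_derivative u (at x) (\<Sum>c\<in>Basis. (h \<bullet> c) *\<^sub>R c)"
      by (simp add: euclidean_representation)
    also have "\<dots> = (\<Sum>c\<in>Basis. (h \<bullet> c) * partial c u x)"
      by (simp add: linear_sum[OF lin] linear_cmul[OF lin] partial_def)
    finally show ?thesis .
  qed
  then have "frechet_derivative u (at x) = (\<lambda>h. \<Sum>c\<in>Basis. (h \<bullet> c) * partial c u x)" by blast
  with d show ?thesis by simp
qed

lemma partial_cong_open:
  assumes "open S" "x \<in> S" "\<And>y. y \<in> S \<Longrightarrow> u y = v y" "v differentiable (at x)"
  shows "u differentiable (at x)" and "partial b u x = partial b v x"
proof -
  obtain D where D: "(v has_derivative D) (at x)" using assms(4) unfolding differentiable_def by blast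
  then have "(u has_derivative D) (at x)"
    using has_derivative_transform_within_open[OF D assms(1,2)] assms(3) by metis
  then show "u differentiable (at x)" "partial b u x = partial b v x"
    using D by (auto simp: differentiable_def partial_eq)
qed

text \<open>The candidates \<open>P\<close> and \<open>Q\<close> agree with \<open>partial\<close>
  only on \<open>S\<close>. Openness of \<open>S\<close> is what allows the identity
  \<open>partial b u = P b\<close> to be differentiated once more.\<close>

lemma C2_onI:
  fixes u :: "'a::euclidean_space \<Rightarrow> real"
  assumes S: "open S"
    and P: "\<And>x. x \<in> S \<Longrightarrow> (u has_derivative (\<lambda>h. \<Sum>b\<in>Basis. (h \<bullet> b) * P b x)) (at x)"
    and Q: "\<And>x b. x \<in> S \<Longrightarrow> b \<in> Basis \<Longrightarrow>
              (P b has_derivative (\<lambda>h. \<Sum>c\<in>Basis. (h \<bullet> c) * Q b c x)) (at x)"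
    and Q': "\<And>b c. b \<in> Basis \<Longrightarrow> c \<in> Basis \<Longrightarrow> continuous_on S (Q b c)"
  shows "C2_on S u"
    and "\<And>x b. x \<in> S \<Longrightarrow> b \<in> Basis \<Longrightarrow> partial b u x = P b x"
    and "\<And>x b c. x \<in> S \<Longrightarrow> b \<in> Basis \<Longrightarrow> c \<in> Basis \<Longrightarrow> partial c (partial b u) x = Q b c x"
    and "\<And>x. x \<in> S \<Longrightarrow> laplacian u x = (\<Sum>b\<in>Basis. Q b b x)"
proof -
  have sum: "(\<Sum>c\<in>Basis. (b \<bullet> c) * R c) = R b" if "b \<in> Basis" for b :: 'a and R
    using that by (simp add: inner_Basis if_distrib[of "\<lambda>t. t * _"] cong: if_cong)
  show 1: "partial b u x = P b x" if "x \<in> S" "b \<in> Basis" for x b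
    using partial_eq[OF P[OF that(1)], of b] sum[OF that(2)] by simp
  have dP: "P b differentiable (at x)" if "x \<in> S" "b \<in> Basis" for x b
    using Q[OF that] unfolding differentiable_def by blast
  show 2: "partial c (partial b u) x = Q b c x" if "x \<in> S" "b \<in> Basis" "c \<in> Basis" for x b c
    using partial_cong_open(2)[OF S that(1) 1 dP] that partial_eq[OF Q[OF that(1,2)], of c]
      sum[OF that(3)] by simp
  show "C2_on S u" unfolding C2_on_def
  proof (intro conjI ballI)
    fix x assume "x \<in> S" then show "u differentiable (at x)"
      using P unfolding differentiable_def by blast
  next
    fix b :: 'a and x assume "b \<in> Basis" "x \<in> S"
    then show "partial b u differentiable (at x)"
      using partial_cong_open(1)[OF S _ 1 dP] by blast
  next
    fix b c :: 'a assume bc: "b \<in> Basis" "c \<in> Basis"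
    show "continuous_on S (partial c (partial b u))"
      using Q'[OF bc] 2 bc continuous_on_cong[OF refl, of S "partial c (partial b u)" "Q b c"] by simp
  qed
  show "laplacian u x = (\<Sum>b\<in>Basis. Q b b x)" if "x \<in> S" for x
    unfolding laplacian_def using 2 that by simp
qed

lemma C2_onD:
  fixes u :: "'a::euclidean_space \<Rightarrow> real"
  assumes "C2_on S u" "x \<in> S"
  shows "(u has_derivative (\<lambda>h. \<Sum>b\<in>Basis. (h \<bullet> b) * partial b u x)) (at x)"
    and "b \<in> Basis \<Longrightarrow> (partial b u has_derivative
           (\<lambda>h. \<Sum>c\<in>Basis. (h \<bullet> c) * partial c (partial b u) x)) (at x)"
  using assms by (auto simp: C2_on_def intro: differentiable_partials)

lemma C2_on_subset: "C2_on S u \<Longrightarrow> T \<subseteq> S \<Longrightarrow> C2_on T u"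
  unfolding C2_on_def by (meson continuous_on_subset subsetD)

lemma C2_on_linear_combination:
  fixes u v :: "'a::euclidean_space \<Rightarrow> real"
  assumes S: "open S" and u: "C2_on S u" and v: "C2_on S v"
  shows "C2_on S (\<lambda>x. p * u x + q * v x)"
    and "x \<in> S \<Longrightarrow> laplacian (\<lambda>x. p * u x + q * v x) x = p * laplacian u x + q * laplacian v x"
proof -
  have *: "(\<lambda>h. p * (\<Sum>b\<in>Basis. (h \<bullet> b) * A b) + q * (\<Sum>b\<in>Basis. (h \<bullet> b) * B b)) =
     (\<lambda>h. \<Sum>b\<in>Basis. (h \<bullet> b) * (p * A b + q * B b))" for A B :: "'a \<Rightarrow> real"
    by (auto simp: sum_distrib_left sum.distrib algebra_simps)
  have P: "((\<lambda>x. p * u x + q * v x) has_derivative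
      (\<lambda>h. \<Sum>b\<in>Basis. (h \<bullet> b) * (p * partial b u x + q * partial b v x))) (at x)" if "x \<in> S" for x
    unfolding *[symmetric]
    by (intro has_derivative_add has_derivative_mult_right C2_onD(1)[OF u] C2_onD(1)[OF v] that)
  have Q: "((\<lambda>x. p * partial b u x + q * partial b v x) has_derivative
      (\<lambda>h. \<Sum>c\<in>Basis. (h \<bullet> c) * (p * partial c (partial b u) x + q * partial c (partial b v) x))) (at x)"
    if "x \<in> S" "b \<in> Basis" for x b
    unfolding *[symmetric]
    by (intro has_derivative_add has_derivative_mult_right C2_onD(2)[OF u] C2_onD(2)[OF v] that)
  have C: "continuous_on S (\<lambda>x. p * partial c (partial b u) x + q * partial c (partial b v) x)"
    if "b \<in> Basis" "c \<in> Basis" for b c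
    using u v that unfolding C2_on_def by (intro continuous_intros) auto
  show "C2_on S (\<lambda>x. p * u x + q * v x)" using C2_onI(1)[OF S P Q C] .
  show "laplacian (\<lambda>x. p * u x + q * v x) x = p * laplacian u x + q * laplacian v x" if "x \<in> S"
    using C2_onI(4)[OF S P Q C that] by (simp add: laplacian_def sum.distrib sum_distrib_left)
qed

text \<open>Covers both changes of variables used later: reflections in hyperplanes
  (\<open>k = 1\<close>) and dilations by \<open>r\<close> (\<open>k = r\<^sup>2\<close>).\<close>

lemma C2_on_compose_selfadjoint:
  fixes u :: "'a::euclidean_space \<Rightarrow> real" and A :: "'a \<Rightarrow> 'a"
  assumes S: "open S" and u: "C2_on S u" and A: "linear A"
    and adj: "\<And>x y. A x \<bullet> y = x \<bullet> A y" and sq: "\<And>x. A (A x) = k *\<^sub>R x"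
  shows "C2_on (A -` S) (\<lambda>x. u (A x))"
    and "A x \<in> S \<Longrightarrow> laplacian (\<lambda>x. u (A x)) x = k * laplacian u (A x)"
proof -
  define T where "T = A -` S"
  have cont: "continuous_on X A" for X using A linear_continuous_on linear_conv_bounded_linear by blast
  have T: "open T" unfolding T_def by (rule open_vimage[OF S cont])
  have dA: "(A has_derivative A) F" for F
    using A bounded_linear_imp_has_derivative linear_conv_bounded_linear by blast
  have *: "(\<lambda>h. \<Sum>c\<in>Basis. (A h \<bullet> c) * g c) = (\<lambda>h. \<Sum>b\<in>Basis. (h \<bullet> b) * (\<Sum>c\<in>Basis. (A b \<bullet> c) * g c))"
    for g :: "'a \<Rightarrow> real"
  proof
    fix h
    have Ah: "A h \<bullet> c = (\<Sum>b\<in>Basis. (h \<bullet> b) * (A b \<bullet> c))" for c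
      unfolding adj by (subst euclidean_inner) (simp add: inner_commute)
    show "(\<Sum>c\<in>Basis. (A h \<bullet> c) * g c) = (\<Sum>b\<in>Basis. (h \<bullet> b) * (\<Sum>c\<in>Basis. (A b \<bullet> c) * g c))"
      by (simp only: Ah sum_distrib_left sum_distrib_right mult.assoc) (rule sum.swap)
  qed
  have P: "((\<lambda>x. u (A x)) has_derivative
      (\<lambda>h. \<Sum>b\<in>Basis. (h \<bullet> b) * (\<Sum>c\<in>Basis. (A b \<bullet> c) * partial c u (A x)))) (at x)" if "x \<in> T" for x
    using has_derivative_compose[OF dA C2_onD(1)[OF u, of "A x"], of UNIV] that
    unfolding *[symmetric] by (simp add: T_def)
  have P2: "((\<lambda>x. partial c u (A x)) has_derivative
      (\<lambda>h. \<Sum>b\<in>Basis. (h \<bullet> b) * (\<Sum>d\<in>Basis. (A b \<bullet> d) * partial d (partial c u) (A x)))) (at x)"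
      if "x \<in> T" "c \<in> Basis" for x c
    using has_derivative_compose[OF dA C2_onD(2)[OF u, of "A x" c], of UNIV] that
    unfolding *[symmetric] by (simp add: T_def)
  have Q: "((\<lambda>x. \<Sum>c\<in>Basis. (A b \<bullet> c) * partial c u (A x)) has_derivative
      (\<lambda>h. \<Sum>e\<in>Basis. (h \<bullet> e) * (\<Sum>c\<in>Basis. (A b \<bullet> c) * (\<Sum>d\<in>Basis. (A e \<bullet> d) * partial d (partial c u) (A x))))) (at x)"
      if "x \<in> T" "b \<in> Basis" for x b
  proof -
    have "((\<lambda>x. \<Sum>c\<in>Basis. (A b \<bullet> c) * partial c u (A x)) has_derivative
      (\<lambda>h. \<Sum>c\<in>Basis. (A b \<bullet> c) * (\<Sum>e\<in>Basis. (h \<bullet> e) * (\<Sum>d\<in>Basis. (A e \<bullet> d) * partial d (partial c u) (A x))))) (at x)"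
      by (intro has_derivative_sum has_derivative_mult_right P2 that)
    moreover have "(\<Sum>c\<in>Basis. (A b \<bullet> c) * (\<Sum>e\<in>Basis. (h \<bullet> e) * g c e)) =
      (\<Sum>e\<in>Basis. (h \<bullet> e) * (\<Sum>c\<in>Basis. (A b \<bullet> c) * g c e))" for h :: 'a and g :: "'a \<Rightarrow> 'a \<Rightarrow> real"
      by (simp only: sum_distrib_left mult.left_commute[of "A b \<bullet> _"]) (rule sum.swap)
    ultimately show ?thesis by simp
  qed
  have comp: "continuous_on T (\<lambda>x. partial d (partial c u) (A x))" if "c \<in> Basis" "d \<in> Basis" for c d
    using u that unfolding C2_on_def
    by (intro continuous_on_compose2[of S "partial d (partial c u)" T A] cont) (auto simp: T_def)
  have C: "continuous_on T (\<lambda>x. \<Sum>c\<in>Basis. (A b \<bullet> c) * (\<Sum>d\<in>Basis. (A e \<bullet> d) * partial d (partial c u) (A x)))"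
    for b e by (intro continuous_intros comp)
  show "C2_on (A -` S) (\<lambda>x. u (A x))" using C2_onI(1)[OF T P Q C] unfolding T_def .
  show "laplacian (\<lambda>x. u (A x)) x = k * laplacian u (A x)" if "A x \<in> S"
  proof -
    have xT: "x \<in> T" using that by (simp add: T_def)
    \<comment> \<open>The matrix of \<open>A\<close> is symmetric with square \<open>k\<close> times
      the identity. Contracting the Hessian with it therefore leaves \<open>k\<close> times the
      trace.\<close>
    have orth: "(\<Sum>b\<in>Basis. (A b \<bullet> c) * (A b \<bullet> d)) = k * (c \<bullet> d)" for c d
    proof -
      have e: "A b \<bullet> a = A a \<bullet> b" for a b by (metis adj inner_commute)
      have "(\<Sum>b\<in>Basis. (A b \<bullet> c) * (A b \<bullet> d)) = (\<Sum>b\<in>Basis. (A c \<bullet> b) * (A d \<bullet> b))"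
        by (intro sum.cong refl arg_cong2[where f = "(*)"] e)
      also have "\<dots> = A c \<bullet> A d" by (rule euclidean_inner[symmetric])
      also have "\<dots> = A (A c) \<bullet> d" by (rule adj[symmetric])
      also have "\<dots> = k * (c \<bullet> d)" by (simp add: sq)
      finally show ?thesis .
    qed
    have "laplacian (\<lambda>x. u (A x)) x =
      (\<Sum>b\<in>Basis. \<Sum>c\<in>Basis. (A b \<bullet> c) * (\<Sum>d\<in>Basis. (A b \<bullet> d) * partial d (partial c u) (A x)))"
      using C2_onI(4)[OF T P Q C xT] .
    also have "\<dots> = (\<Sum>b\<in>Basis. \<Sum>c\<in>Basis. \<Sum>d\<in>Basis. ((A b \<bullet> c) * (A b \<bullet> d)) * partial d (partial c u) (A x))"
      by (simp add: sum_distrib_left mult.assoc)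
    also have "\<dots> = (\<Sum>c\<in>Basis. \<Sum>b\<in>Basis. \<Sum>d\<in>Basis. ((A b \<bullet> c) * (A b \<bullet> d)) * partial d (partial c u) (A x))"
      by (rule sum.swap)
    also have "\<dots> = (\<Sum>c\<in>Basis. \<Sum>d\<in>Basis. \<Sum>b\<in>Basis. ((A b \<bullet> c) * (A b \<bullet> d)) * partial d (partial c u) (A x))"
      by (rule sum.cong[OF refl]) (rule sum.swap)
    also have "\<dots> = (\<Sum>c\<in>Basis. \<Sum>d\<in>Basis. (k * (c \<bullet> d)) * partial d (partial c u) (A x))"
      by (simp add: sum_distrib_right[symmetric] orth)
    also have "\<dots> = (\<Sum>c\<in>Basis. k * partial c (partial c u) (A x))"
      by (intro sum.cong refl) (simp add: inner_Basis if_distrib[of "\<lambda>t. t * _"] if_distrib[of "\<lambda>t. _ * t"] cong: if_cong)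
    finally show ?thesis by (simp add: laplacian_def sum_distrib_left)
  qed
qed

section \<open>Coordinate lines and the second-order condition at a minimum\<close>

lemma C2_on_line:
  fixes u :: "'a::euclidean_space \<Rightarrow> real"
  assumes "C2_on S u" "b \<in> Basis" "x + t *\<^sub>R b \<in> S"
  shows "((\<lambda>t. u (x + t *\<^sub>R b)) has_real_derivative partial b u (x + t *\<^sub>R b)) (at t)"
    and "((\<lambda>t. partial b u (x + t *\<^sub>R b)) has_real_derivative partial b (partial b u) (x + t *\<^sub>R b)) (at t)"
proof -
  have l: "((\<lambda>t. x + t *\<^sub>R b) has_derivative (\<lambda>h. h *\<^sub>R b)) (at t)"
    by (auto intro!: derivative_eq_intros)
  have sum: "(\<Sum>c\<in>Basis. ((h *\<^sub>R b) \<bullet> c) * R c) = R b * h" for h :: real and R :: "'a \<Rightarrow> real"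
    using assms(2) by (simp add: inner_Basis if_distrib[of "\<lambda>t. t * _"] if_distrib[of "\<lambda>t. _ * t"] cong: if_cong)
  show "((\<lambda>t. u (x + t *\<^sub>R b)) has_real_derivative partial b u (x + t *\<^sub>R b)) (at t)"
    using has_derivative_compose[OF l C2_onD(1)[OF assms(1,3)]] unfolding sum has_field_derivative_def .
  show "((\<lambda>t. partial b u (x + t *\<^sub>R b)) has_real_derivative partial b (partial b u) (x + t *\<^sub>R b)) (at t)"
    using has_derivative_compose[OF l C2_onD(2)[OF assms(1,3,2)]] unfolding sum has_field_derivative_def .
qed

lemma second_derivative_local_min:
  fixes g g' :: "real \<Rightarrow> real"
  assumes e: "e > 0" and g: "\<And>t. \<bar>t\<bar> < e \<Longrightarrow> (g has_real_derivative g' t) (at t)"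
    and g': "(g' has_real_derivative d) (at 0)" and min: "\<And>t. \<bar>t\<bar> < e \<Longrightarrow> g 0 \<le> g t"
  shows "d \<ge> 0"
proof (rule ccontr)
  assume "\<not> d \<ge> 0"
  then have d: "d < 0" by simp
  have "g' 0 = 0"
    using DERIV_local_min[OF g[of 0] e] min e by simp
  with DERIV_neg_dec_right[OF g' d] obtain s where s: "s > 0" "\<And>h. 0 < h \<Longrightarrow> h < s \<Longrightarrow> g' h < 0"
    by auto
  define t where "t = min s e / 2"
  have t: "0 < t" "t < s" "t < e" using s(1) e by (auto simp: t_def min_def)
  have "g t < g 0"
  proof (rule DERIV_neg_imp_decreasing_open[OF t(1)])
    fix x assume "0 < x" "x < t"
    then show "\<exists>y. (g has_real_derivative y) (at x) \<and> y < 0" using g[of x] s(2)[of x] t by auto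
  next
    show "continuous_on {0..t} g"
      by (rule DERIV_continuous_on[where D = g'], rule has_field_derivative_at_within, rule g)
         (use t in auto)
  qed
  then show False using min[of t] t by simp
qed

text \<open>Each pure second derivative is nonnegative by the one-variable test along a coordinate
  line. This is the form of the maximum principle used for the supersolution and eigenfunction
  comparisons.\<close>

lemma laplacian_local_min:
  fixes u :: "'a::euclidean_space \<Rightarrow> real"
  assumes S: "open S" and u: "C2_on S u" and x: "x \<in> S" and min: "\<And>y. y \<in> S \<Longrightarrow> u x \<le> u y"
  shows "laplacian u x \<ge> 0"
  unfolding laplacian_def
proof (rule sum_nonneg)
  fix b :: 'a assume b: "b \<in> Basis"
  obtain e where e: "e > 0" "ball x e \<subseteq> S" using S x open_contains_ball by blast
  have inS: "x + t *\<^sub>R b \<in> S" if "\<bar>t\<bar> < e" for t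
    using e(2) that b by (auto simp: subset_iff dist_norm)
  show "partial b (partial b u) x \<ge> 0"
    by (rule second_derivative_local_min[OF e(1), of "\<lambda>t. u (x + t *\<^sub>R b)" "\<lambda>t. partial b u (x + t *\<^sub>R b)"])
       (use C2_on_line[OF u b] inS min C2_on_line(2)[OF u b, of x 0] x in auto)
qed

section \<open>The radial equation\<close>

text \<open>A first-order system with \<open>w\<close> in the role of \<open>-V'\<close>, so that no
  derivative at the singular point 0 is mentioned. The vanishing of the flux
  \<open>r ^ (N - 1) * w r\<close> takes the place of \<open>V'(0) = 0\<close>.\<close>

definition radial_solution ::
    "nat \<Rightarrow> (real \<Rightarrow> real) \<Rightarrow> real \<Rightarrow> (real \<Rightarrow> real) \<Rightarrow> (real \<Rightarrow> real) \<Rightarrow> bool" where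
  "radial_solution N f lam V w \<longleftrightarrow>
     continuous_on {0..1} V \<and> V 1 = 0 \<and>
     (\<forall>r\<in>{0<..<1}. V r > 0 \<and> (V has_real_derivative - w r) (at r) \<and>
        (w has_real_derivative lam * f (V r) - (real N - 1) / r * w r) (at r)) \<and>
     ((\<lambda>r. r ^ (N - 1) * w r) \<longlongrightarrow> 0) (at_right 0)"

text \<open>The coefficients of the radial equation are singular at 0, so a one-sided limit serves
  as the initial value in all integrations from the origin.\<close>

lemma nonneg_of_deriv_nonneg:
  fixes D D' :: "real \<Rightarrow> real"
  assumes r: "0 < r" and lim: "(D \<longlongrightarrow> 0) (at_right 0)"
    and der: "\<And>s. 0 < s \<Longrightarrow> s \<le> r \<Longrightarrow> (D has_real_derivative D' s) (at s)"
    and nonneg: "\<And>s. 0 < s \<Longrightarrow> s \<le> r \<Longrightarrow> 0 \<le> D' s"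
  shows "0 \<le> D r"
proof (rule tendsto_upperbound[OF lim])
  have "D s \<le> D r" if "0 < s" "s < r" for s
    by (rule DERIV_nonneg_imp_nondecreasing[of s r D]) (use that der nonneg in force)+
  then show "\<forall>\<^sub>F s in at_right 0. D s \<le> D r"
    using r eventually_at_right by blast
qed simp

locale radial_problem =
  fixes N :: nat and f :: "real \<Rightarrow> real" and lam :: real and V w :: "real \<Rightarrow> real"
  assumes N: "N \<ge> 3" and lam: "lam > 0" and f_mono: "mono_on {0..} f" and f_pos: "f 0 > 0"
    and sol: "radial_solution N f lam V w"
begin

lemma V_cont: "continuous_on {0..1} V" and V_1: "V 1 = 0"
  and V_pos: "0 < r \<Longrightarrow> r < 1 \<Longrightarrow> V r > 0"
  and V_deriv: "0 < r \<Longrightarrow> r < 1 \<Longrightarrow> (V has_real_derivative - w r) (at r)"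
  and w_deriv: "0 < r \<Longrightarrow> r < 1 \<Longrightarrow>
        (w has_real_derivative lam * f (V r) - (real N - 1) / r * w r) (at r)"
  and flux_lim: "((\<lambda>r. r ^ (N - 1) * w r) \<longlongrightarrow> 0) (at_right 0)"
  using sol unfolding radial_solution_def by auto

section \<open>Flux estimates and monotonicity of the radial profile\<close>

lemma f_ge: "0 \<le> t \<Longrightarrow> f 0 \<le> f t"
  using f_mono by (auto simp: mono_on_def)

text \<open>Divergence form of the equation: the weight \<open>r ^ (N - 1)\<close> absorbs the
  singular first-order term.\<close>

lemma flux_deriv:
  assumes "0 < r" "r < 1"
  shows "((\<lambda>r. r ^ (N - 1) * w r) has_real_derivative lam * r ^ (N - 1) * f (V r)) (at r)"
proof -
  define m where "m = N - 2"
  have m: "N = Suc (Suc m)" using N by (simp add: m_def)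
  show ?thesis
    using assms unfolding m
    by (auto intro!: derivative_eq_intros w_deriv simp: m divide_simps)
       (cases m; simp add: algebra_simps)
qed

text \<open>The subtracted term \<open>lam * A * s ^ N / real N\<close> is the flux of a constant
  source \<open>A\<close>. One-sided bounds on \<open>f (V s)\<close> thus turn into bounds on the
  flux.\<close>

lemma flux_diff_deriv:
  assumes "0 < r" "r < 1"
  shows "((\<lambda>s. s ^ (N - 1) * w s - lam * A * s ^ N / real N) has_real_derivative
           lam * r ^ (N - 1) * (f (V r) - A)) (at r)"
proof -
  have "((\<lambda>s. lam * A * s ^ N / real N) has_real_derivative lam * A * r ^ (N - 1)) (at r)"
    using N by (auto intro!: derivative_eq_intros)
  from DERIV_diff[OF flux_deriv[OF assms] this] show ?thesis
    by (simp add: algebra_simps)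
qed

lemma flux_diff_lim: "((\<lambda>s. s ^ (N - 1) * w s - lam * A * s ^ N / real N) \<longlongrightarrow> 0) (at_right 0)"
proof -
  have "((\<lambda>s::real. lam * A * s ^ N / real N) \<longlongrightarrow> 0) (at_right 0)"
    using N by (auto intro!: tendsto_eq_intros)
  from tendsto_diff[OF flux_lim this] show ?thesis by simp
qed

lemma flux_ge:
  assumes r: "0 < r" "r < 1" and A: "\<And>s. 0 < s \<Longrightarrow> s \<le> r \<Longrightarrow> A \<le> f (V s)"
  shows "lam * A * r ^ N / real N \<le> r ^ (N - 1) * w r"
proof -
  have "0 \<le> r ^ (N - 1) * w r - lam * A * r ^ N / real N"
  proof (rule nonneg_of_deriv_nonneg[OF r(1) flux_diff_lim])
    show "((\<lambda>s. s ^ (N - 1) * w s - lam * A * s ^ N / real N) has_real_derivative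
           lam * s ^ (N - 1) * (f (V s) - A)) (at s)" if "0 < s" "s \<le> r" for s
      using flux_diff_deriv that r by simp
    show "0 \<le> lam * s ^ (N - 1) * (f (V s) - A)" if "0 < s" "s \<le> r" for s
      using A[OF that] that lam by simp
  qed
  then show ?thesis by simp
qed

lemma flux_le:
  assumes r: "0 < r" "r < 1" and A: "\<And>s. 0 < s \<Longrightarrow> s \<le> r \<Longrightarrow> f (V s) \<le> A"
  shows "r ^ (N - 1) * w r \<le> lam * A * r ^ N / real N"
proof -
  have "0 \<le> - (r ^ (N - 1) * w r - lam * A * r ^ N / real N)"
  proof (rule nonneg_of_deriv_nonneg[OF r(1)])
    show "((\<lambda>s. - (s ^ (N - 1) * w s - lam * A * s ^ N / real N)) \<longlongrightarrow> 0) (at_right 0)"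
      using tendsto_minus[OF flux_diff_lim] by simp
    show "((\<lambda>s. - (s ^ (N - 1) * w s - lam * A * s ^ N / real N)) has_real_derivative
           - (lam * s ^ (N - 1) * (f (V s) - A))) (at s)" if "0 < s" "s \<le> r" for s
      using that r by (intro DERIV_minus flux_diff_deriv) auto
    show "0 \<le> - (lam * s ^ (N - 1) * (f (V s) - A))" if "0 < s" "s \<le> r" for s
      using A[OF that] that lam by (simp add: mult_nonneg_nonpos)
  qed
  then show ?thesis by simp
qed

lemma w_pos: "0 < r \<Longrightarrow> r < 1 \<Longrightarrow> 0 < w r"
proof -
  assume r: "0 < r" "r < 1"
  have "0 < lam * f 0 * r ^ N / real N" using r lam f_pos N by simp
  moreover have "lam * f 0 * r ^ N / real N \<le> r ^ (N - 1) * w r"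
    using r V_pos by (intro flux_ge f_ge) (auto intro: less_imp_le)
  ultimately have "0 < r ^ (N - 1) * w r" by linarith
  with r show ?thesis by (simp add: zero_less_mult_iff)
qed

lemma V_antimono:
  assumes "0 \<le> r" "r \<le> s" "s \<le> 1"
  shows "V s \<le> V r"
proof (rule DERIV_nonpos_imp_decreasing_open[OF assms(2), of V])
  show "\<exists>y. (V has_real_derivative y) (at x) \<and> y \<le> 0" if "r < x" "x < s" for x
    using V_deriv[of x] w_pos[of x] that assms by (intro exI[of _ "- w x"]) auto
  show "continuous_on {r..s} V" using V_cont by (rule continuous_on_subset) (use assms in auto)
qed

lemma V_nonneg: "0 \<le> r \<Longrightarrow> r \<le> 1 \<Longrightarrow> 0 \<le> V r"
  using V_antimono[of r 1] V_1 by simp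

lemma f_V_antimono: "0 \<le> r \<Longrightarrow> r \<le> s \<Longrightarrow> s \<le> 1 \<Longrightarrow> f (V s) \<le> f (V r)"
  using f_mono V_antimono[of r s] V_nonneg[of s] V_nonneg[of r] by (auto simp: mono_on_def)

text \<open>Since \<open>V\<close> decreases, \<open>f (V s)\<close> lies between
  \<open>f (V r)\<close> and \<open>f (V 0)\<close> for \<open>0 < s \<le> r\<close>. The two bounds
  merge as \<open>r\<close> tends to 0, which gives the limit of \<open>w r / r\<close> at the
  origin.\<close>

lemma w_over_r_bounds:
  assumes "0 < r" "r < 1"
  shows "lam * f (V r) / real N \<le> w r / r" and "w r / r \<le> lam * f (V 0) / real N"
proof -
  define m where "m = N - 1"
  have m: "N = Suc m" using N by (simp add: m_def)
  have "lam * f (V r) * r ^ N / real N \<le> r ^ (N - 1) * w r"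
    using assms by (intro flux_ge f_V_antimono) auto
  moreover have "r ^ (N - 1) * w r \<le> lam * f (V 0) * r ^ N / real N"
    using assms by (intro flux_le f_V_antimono) auto
  ultimately have "r ^ m * (lam * f (V r) / real N * r) \<le> r ^ m * w r"
    "r ^ m * w r \<le> r ^ m * (lam * f (V 0) / real N * r)"
    by (simp_all add: m mult_ac)
  then have "lam * f (V r) / real N * r \<le> w r" "w r \<le> lam * f (V 0) / real N * r"
    using assms by (simp_all only: mult_le_cancel_left_pos zero_less_power)
  then show "lam * f (V r) / real N \<le> w r / r" "w r / r \<le> lam * f (V 0) / real N"
    using assms by (simp_all only: pos_le_divide_eq pos_divide_le_eq)
qed

section \<open>Bounds on the profile away from the origin and at the origin\<close>

lemma flux_mono:
  assumes "0 < r" "r \<le> s" "s < 1"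
  shows "r ^ (N - 1) * w r \<le> s ^ (N - 1) * w s"
proof (rule DERIV_nonneg_imp_nondecreasing[OF assms(2), of "\<lambda>r. r ^ (N - 1) * w r"])
  fix x assume "r \<le> x" "x \<le> s"
  then have x: "0 < x" "x < 1" using assms by auto
  then have "0 \<le> lam * x ^ (N - 1) * f (V x)"
    using lam f_pos f_ge[of "V x"] V_pos[OF x] by (intro mult_nonneg_nonneg) auto
  then show "\<exists>y. ((\<lambda>r. r ^ (N - 1) * w r) has_real_derivative y) (at x) \<and> 0 \<le> y"
    using flux_deriv[OF x] by blast
qed

text \<open>The flux increases and \<open>x ^ (N - 1) \<le> 1\<close>, so \<open>w\<close> stays
  above the value of the flux at \<open>r\<close> on the whole interval up to 1. Integrating from
  \<open>r\<close> to the boundary, where \<open>V\<close> vanishes, gives the factor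
  \<open>1 - r\<close>.\<close>

lemma V_ge_flux:
  assumes "0 < r" "r < 1"
  shows "r ^ (N - 1) * w r * (1 - r) \<le> V r"
proof -
  define k where "k = r ^ (N - 1) * w r"
  have "V 1 + k * 1 \<le> V r + k * r"
  proof (rule DERIV_nonpos_imp_decreasing_open[of r 1 "\<lambda>r. V r + k * r"])
    fix x assume x: "r < x" "x < 1"
    have "k \<le> x ^ (N - 1) * w x" unfolding k_def using flux_mono[of r x] x assms by simp
    also have "\<dots> \<le> 1 * w x"
      using x assms w_pos[of x] by (intro mult_right_mono power_le_one) auto
    finally show "\<exists>y. ((\<lambda>r. V r + k * r) has_real_derivative y) (at x) \<and> y \<le> 0"
      using x assms by (intro exI[of _ "- w x + k"]) (auto intro!: derivative_eq_intros V_deriv)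
  next
    show "continuous_on {r..1} (\<lambda>r. V r + k * r)"
      using assms by (intro continuous_intros continuous_on_subset[OF V_cont]) auto
  qed (use assms in simp)
  then show ?thesis by (simp add: k_def V_1 algebra_simps)
qed

text \<open>Bounds \<open>f (V r)\<close> linearly by \<open>V r\<close>. Together with
  superlinearity of \<open>f\<close>, this controls \<open>V r\<close> uniformly as long as
  \<open>lam\<close> stays away from 0.\<close>

lemma f_V_bound:
  assumes "0 < r" "r < 1"
  shows "lam * f (V r) * (r ^ N * (1 - r)) / real N \<le> V r"
proof -
  have "lam * f (V r) * r ^ N / real N * (1 - r) \<le> r ^ (N - 1) * w r * (1 - r)"
    using assms by (intro mult_right_mono flux_ge f_V_antimono) auto
  with V_ge_flux[OF assms] show ?thesis by (simp add: algebra_simps)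
qed

text \<open>Sturm comparison of \<open>w\<close> with \<open>r\<^sup>-\<^sup>\<alpha>\<close>: up to a power of \<open>r\<close>, the function \<open>q\<close> below is the derivative
  of \<open>r\<^sup>\<alpha> w\<close>. The critical exponent \<open>\<alpha> = 1\<close> turns the bound \<open>(N - 1 - \<alpha>) (1 + \<alpha>)\<close> into \<open>2 (N - 2)\<close>.\<close>

lemma powr_w_mono:
  fixes f' :: "real \<Rightarrow> real"
  assumes f': "\<And>t. t \<ge> 0 \<Longrightarrow> (f has_real_derivative f' t) (at t within {0..})"
    and \<alpha>: "0 < \<alpha>" "\<alpha> < 1" and R: "R < 1"
    and bound: "\<And>r. 0 < r \<Longrightarrow> r \<le> R \<Longrightarrow> r\<^sup>2 * (lam * f' (V r)) \<le> (real N - 1 - \<alpha>) * (1 + \<alpha>)"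
    and r: "0 < r" "r \<le> R"
  shows "r powr \<alpha> * w r \<le> R powr \<alpha> * w R"
proof -
  define \<beta> where "\<beta> = real N - 1 - \<alpha>"
  have \<beta>: "\<beta> > 0" using N \<alpha> by (auto simp: \<beta>_def)
  \<comment> \<open>The weight \<open>r powr \<beta>\<close> is chosen so that the terms with
    \<open>f (V r)\<close> cancel in the derivative. What remains is a multiple of \<open>w\<close>,
    whose sign is decided by \<open>bound\<close>.\<close>
  define q where "q r = r powr \<beta> * (lam * f (V r) - \<beta> / r * w r)" for r
  define q' where "q' r = r powr (\<beta> - 2) * w r * (\<beta> * (1 + \<alpha>) - r\<^sup>2 * (lam * f' (V r)))" for r
  have fV: "((\<lambda>r. f (V r)) has_real_derivative f' (V r) * (- w r)) (at r)" if "0 < r" "r < 1" for r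
  proof (rule DERIV_chain2[OF _ V_deriv[OF that]])
    \<comment> \<open>The derivative of \<open>f\<close> is given only within \<open>{0..}\<close>;
      positivity of \<open>V r\<close> makes it two-sided.\<close>
    have "V r \<in> interior {0..}" using V_pos[OF that] by simp
    from at_within_interior[OF this] show "(f has_real_derivative f' (V r)) (at (V r))"
      using f'[of "V r"] V_pos[OF that] by (metis less_imp_le)
  qed
  have q: "(q has_real_derivative q' r) (at r)" if "0 < r" "r < 1" for r
  proof -
    have d: "((\<lambda>r. \<beta> / r) has_real_derivative - \<beta> / r\<^sup>2) (at r)"
      using that by (auto intro!: derivative_eq_intros simp: power2_eq_square)
    let ?q' = "\<beta> * r powr (\<beta> - 1) * (lam * f (V r) - \<beta> / r * w r) +
      (lam * (f' (V r) * (- w r)) -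
        (- \<beta> / r\<^sup>2 * w r + (lam * f (V r) - (real N - 1) / r * w r) * (\<beta> / r))) * r powr \<beta>"
    have "(q has_real_derivative ?q') (at r)"
      unfolding q_def using that
      by (intro DERIV_mult DERIV_diff DERIV_cmult fV d w_deriv has_real_derivative_powr) auto
    moreover have "?q' = q' r"
    proof -
      have p: "r powr (\<beta> - 1) = r powr (\<beta> - 2) * r" "r powr \<beta> = r powr (\<beta> - 2) * r\<^sup>2"
        using that by (simp_all add: powr_diff power2_eq_square)
      have n: "real N - 1 = \<beta> + \<alpha>" by (simp add: \<beta>_def)
      show ?thesis unfolding q'_def p n using that by (simp add: field_simps power2_eq_square)
    qed
    ultimately show ?thesis by simp
  qed
  have q_lim: "(q \<longlongrightarrow> 0) (at_right 0)"
  proof (rule Lim_null_comparison)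
    \<comment> \<open>\<open>C\<close> bounds the bracket in \<open>q\<close> near 0, because
      \<open>w s / s\<close> is bounded there; hence \<open>q s\<close> is at most of order
      \<open>s powr \<beta>\<close> with \<open>\<beta> > 0\<close>.\<close>
    define C where "C = lam * f (V 0) + \<beta> * (lam * f (V 0) / real N)"
    have "\<bar>q s\<bar> \<le> s powr \<beta> * C" if s: "0 < s" "s < 1" for s
    proof -
      have "0 < f (V s)" "f (V s) \<le> f (V 0)"
        using s f_ge[of "V s"] f_pos V_pos[of s] f_V_antimono[of 0 s] by auto
      then have "0 < lam * f (V s)" "lam * f (V s) \<le> lam * f (V 0)" using lam by auto
      moreover have "0 < \<beta> * (w s / s)" using w_pos[OF s] s \<beta> by simp
      moreover have "\<beta> * (w s / s) \<le> \<beta> * (lam * f (V 0) / real N)"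
        using w_over_r_bounds(2)[OF s] \<beta> by (intro mult_left_mono) auto
      ultimately have "\<bar>lam * f (V s) - \<beta> * (w s / s)\<bar> \<le> C" unfolding C_def by linarith
      then show ?thesis unfolding q_def using s by (simp add: abs_mult mult_left_mono)
    qed
    then show "\<forall>\<^sub>F s in at_right 0. norm (q s) \<le> s powr \<beta> * C"
      unfolding eventually_at_right[OF zero_less_one] by (intro exI[of _ 1]) auto
    have "((\<lambda>s::real. s powr \<beta>) \<longlongrightarrow> 0) (at_right 0)"
      using \<beta> by (intro tendsto_zero_powrI[where b = \<beta>] tendsto_ident_at tendsto_const) (auto simp: eventually_at_filter)
    then show "((\<lambda>s. s powr \<beta> * C) \<longlongrightarrow> 0) (at_right 0)" by (rule tendsto_mult_left_zero)
  qed
  have q_nonneg: "0 \<le> q s" if s: "0 < s" "s \<le> R" for s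
  proof (rule nonneg_of_deriv_nonneg[OF s(1) q_lim])
    fix t assume t: "0 < t" "t \<le> s"
    show "(q has_real_derivative q' t) (at t)" using q t s R by simp
    show "0 \<le> q' t" unfolding q'_def \<beta>_def
      using bound[of t] t s R w_pos[of t] by (intro mult_nonneg_nonneg) auto
  qed
  show ?thesis
  proof (rule DERIV_nonneg_imp_nondecreasing[OF r(2), of "\<lambda>s. s powr \<alpha> * w s"])
    fix s assume "r \<le> s" "s \<le> R"
    then have s: "0 < s" "s \<le> R" "s < 1" using r R by auto
    have "((\<lambda>s. s powr \<alpha> * w s) has_real_derivative
        \<alpha> * s powr (\<alpha> - 1) * w s + (lam * f (V s) - (real N - 1) / s * w s) * s powr \<alpha>) (at s)"
      using s by (intro DERIV_mult has_real_derivative_powr w_deriv) auto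
    moreover have "\<alpha> * s powr (\<alpha> - 1) * w s + (lam * f (V s) - (real N - 1) / s * w s) * s powr \<alpha>
        = s powr \<alpha> * (lam * f (V s) - \<beta> / s * w s)"
      using s by (simp add: powr_diff \<beta>_def field_simps)
    moreover have "0 \<le> lam * f (V s) - \<beta> / s * w s"
      using q_nonneg[OF s(1,2)] s unfolding q_def by (simp add: zero_le_mult_iff)
    ultimately show "\<exists>y. ((\<lambda>s. s powr \<alpha> * w s) has_real_derivative y) (at s) \<and> 0 \<le> y" by auto
  qed
qed

text \<open>As \<alpha> < 1, the bound \<open>w \<le> C * x powr (- \<alpha>)\<close> is integrable
  at 0, and integrating it over \<open>(0, R)\<close> controls \<open>V 0 - V R\<close>. By
  \<open>V_ge_flux\<close> the constant is a multiple of \<open>V R\<close>, with a factor depending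
  only on \<open>N\<close>, \<alpha> and \<open>R\<close>.\<close>

lemma V_0_bound:
  fixes f' :: "real \<Rightarrow> real"
  assumes f': "\<And>t. t \<ge> 0 \<Longrightarrow> (f has_real_derivative f' t) (at t within {0..})"
    and \<alpha>: "0 < \<alpha>" "\<alpha> < 1" and R: "0 < R" "R < 1"
    and bound: "\<And>r. 0 < r \<Longrightarrow> r \<le> R \<Longrightarrow> r\<^sup>2 * (lam * f' (V r)) \<le> (real N - 1 - \<alpha>) * (1 + \<alpha>)"
  shows "V 0 \<le> V R * (1 + 1 / ((1 - \<alpha>) * (R ^ (N - 1) * (1 - R))))"
proof -
  define C where "C = R powr \<alpha> * w R"
  have "V 0 + C / (1 - \<alpha>) * 0 powr (1 - \<alpha>) \<le> V R + C / (1 - \<alpha>) * R powr (1 - \<alpha>)"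
  proof (rule DERIV_nonneg_imp_increasing_open[of 0 R "\<lambda>x. V x + C / (1 - \<alpha>) * x powr (1 - \<alpha>)"])
    fix x assume x: "0 < x" "x < R"
    have "x powr \<alpha> * w x \<le> C" unfolding C_def
      using powr_w_mono[OF f' \<alpha> R(2) bound, of x] x by simp
    then have "w x \<le> C * x powr (- \<alpha>)" using x by (simp add: powr_minus field_simps)
    then show "\<exists>y. ((\<lambda>x. V x + C / (1 - \<alpha>) * x powr (1 - \<alpha>)) has_real_derivative y) (at x) \<and> 0 \<le> y"
      using x R \<alpha> by (intro exI[of _ "- w x + C * x powr (- \<alpha>)"])
        (auto intro!: derivative_eq_intros V_deriv)
  next
    show "continuous_on {0..R} (\<lambda>x. V x + C / (1 - \<alpha>) * x powr (1 - \<alpha>))"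
      using R \<alpha> by (intro continuous_intros continuous_on_subset[OF V_cont] continuous_on_powr') auto
  qed (use R in simp)
  moreover have "C * R powr (1 - \<alpha>) = R * w R"
    using R by (simp add: C_def powr_add[symmetric] mult.commute[of _ "w R"] mult.assoc)
  ultimately have "V 0 \<le> V R + (R * w R) / (1 - \<alpha>)" using \<alpha> by simp
  also have "R * w R \<le> 1 * w R" using R w_pos[of R] by (intro mult_right_mono) auto
  then have "(R * w R) / (1 - \<alpha>) \<le> w R / (1 - \<alpha>)" using \<alpha> by (intro divide_right_mono) auto
  also have "w R \<le> V R / (R ^ (N - 1) * (1 - R))"
    using V_ge_flux[OF R] R by (simp add: field_simps)
  then have "w R / (1 - \<alpha>) \<le> V R / (R ^ (N - 1) * (1 - R)) / (1 - \<alpha>)"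
    using \<alpha> by (intro divide_right_mono) auto
  finally show ?thesis by (simp add: field_simps)
qed

end

section \<open>Radial symmetry of minimal solutions\<close>

lemma classical_solution_compose_isometry:
  fixes u :: "'a::euclidean_space \<Rightarrow> real" and A :: "'a \<Rightarrow> 'a"
  assumes u: "classical_solution (ball 0 1) f lam u" and A: "linear A"
    and adj: "\<And>x y. A x \<bullet> y = x \<bullet> A y" and sq: "\<And>x. A (A x) = x"
  shows "classical_solution (ball 0 1) f lam (\<lambda>x. u (A x))"
proof -
  have n: "norm (A x) = norm x" for x by (simp add: norm_eq_sqrt_inner adj sq)
  have cont: "continuous_on X A" for X using A linear_continuous_on linear_conv_bounded_linear by blast
  have vim: "A -` ball 0 1 = ball 0 1" using n by auto
  have C2: "C2_on (ball 0 1) u" using u by (simp add: classical_solution_def)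
  note comp = C2_on_compose_selfadjoint[OF open_ball C2 A adj, of 1]
  show ?thesis unfolding classical_solution_def
  proof (intro conjI ballI)
    show "continuous_on (closure (ball 0 1)) (\<lambda>x. u (A x))"
      using u n unfolding classical_solution_def
      by (intro continuous_on_compose2[of "closure (ball 0 1)" u _ A] cont) auto
    show "C2_on (ball 0 1) (\<lambda>x. u (A x))" using comp(1) sq vim by simp
  next
    fix x :: 'a assume x: "x \<in> ball 0 1"
    then have Ax: "A x \<in> ball 0 1" using n by simp
    show "- laplacian (\<lambda>x. u (A x)) x = lam * f (u (A x))"
      using comp(2)[of x] sq Ax u by (simp add: classical_solution_def)
    show "0 < u (A x)" using u Ax by (simp add: classical_solution_def)
  next
    fix x :: 'a assume "x \<in> frontier (ball 0 1)"
    then show "u (A x) = 0" using u n by (simp add: classical_solution_def)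
  qed
qed

text \<open>The reflection in the hyperplane orthogonal to \<open>x - y\<close> exchanges two points
  of equal norm and maps solutions to solutions. Minimality bounds \<open>u\<close> by its
  reflection, hence \<open>u x\<close> by \<open>u y\<close>; exchanging the roles of the points
  gives equality.\<close>

lemma minimal_solution_radial:
  fixes u :: "'a::euclidean_space \<Rightarrow> real"
  assumes u: "minimal_solution (ball 0 1) f lam u" and "x \<in> ball 0 1" "norm x = norm y"
  shows "u x = u y"
proof -
  have le: "u x \<le> u y" if x: "x \<in> ball 0 1" and xy: "norm x = norm y" for x y :: 'a
  proof (cases "x = y")
    case False
    define d where "d = x - y"
    define A where "A z = z - (2 * (z \<bullet> d) / (d \<bullet> d)) *\<^sub>R d" for z
    have d: "d \<bullet> d \<noteq> 0" using False by (simp add: d_def)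
    have lin: "linear A" unfolding A_def
      by (intro linearI) (simp_all add: algebra_simps add_divide_distrib)
    have adj: "A z \<bullet> y = z \<bullet> A y" for z y
      unfolding A_def by (simp add: inner_diff_left inner_diff_right inner_commute)
    have sq: "A (A z) = z" for z
      using d unfolding A_def by (simp add: inner_diff_left scaleR_left_distrib[symmetric])
    have cl: "classical_solution (ball 0 1) f lam u" using u by (simp add: minimal_solution_def)
    have "classical_solution (ball 0 1) f lam (\<lambda>x. u (A x))"
      by (rule classical_solution_compose_isometry[OF cl lin adj sq])
    then have "u x \<le> u (A x)" using u x unfolding minimal_solution_def by blast
    moreover have "A x = y"
    proof -
      have "x \<bullet> x = y \<bullet> y" using xy by (simp add: norm_eq)
      then have "2 * (x \<bullet> d) = d \<bullet> d"
        by (simp add: d_def inner_diff_left inner_diff_right inner_commute)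
      then show ?thesis using d by (simp add: A_def) (simp add: d_def)
    qed
    ultimately show ?thesis by simp
  qed simp
  have "y \<in> ball 0 1" using assms(2,3) by simp
  from le[OF assms(2,3)] le[OF this assms(3)[symmetric]] show ?thesis by (rule antisym)
qed

text \<open>At a point of the axis spanned by \<open>e\<close>, the Laplacian splits into the second
  derivative along \<open>e\<close> and \<open>DIM('a) - 1\<close> tangential ones. By radial
  symmetry each tangential one equals \<open>- w r / r\<close>.\<close>

lemma minimal_solution_profile:
  fixes u :: "'a::euclidean_space \<Rightarrow> real"
  assumes u: "minimal_solution (ball 0 1) f lam u" and e: "e \<in> Basis" and dim: "DIM('a) \<ge> 2"
  shows "radial_solution DIM('a) f lam (\<lambda>r. u (r *\<^sub>R e)) (\<lambda>r. - partial e u (r *\<^sub>R e))"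
proof -
  define V where "V r = u (r *\<^sub>R e)" for r
  define w where "w r = - partial e u (r *\<^sub>R e)" for r
  have cl: "classical_solution (ball 0 1) f lam u" using u by (simp add: minimal_solution_def)
  then have C2: "C2_on (ball 0 1) u" by (simp add: classical_solution_def)
  have ne: "norm e = 1" using e by simp
  have inb: "r *\<^sub>R e \<in> ball 0 1" if "\<bar>r\<bar> < 1" for r using that ne by simp
  have V: "(V has_real_derivative - w r) (at r)" if "\<bar>r\<bar> < 1" for r
    using C2_on_line(1)[OF C2 e, of 0 r] inb[OF that] by (simp add: V_def w_def[abs_def] fun_eq_iff[symmetric] V_def[abs_def])
  have w: "(w has_real_derivative - partial e (partial e u) (r *\<^sub>R e)) (at r)" if "\<bar>r\<bar> < 1" for r
    using DERIV_minus[OF C2_on_line(2)[OF C2 e, of 0 r]] inb[OF that] by (simp add: w_def[abs_def])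
  have perp: "partial b (partial b u) (r *\<^sub>R e) = - w r / r"
    if r: "0 < r" "r < 1" and b: "b \<in> Basis" "b \<noteq> e" for r b
  proof -
    \<comment> \<open>Moving by \<open>t\<close> in the direction \<open>b\<close>, orthogonal to
      \<open>e\<close>, changes the norm to \<open>\<rho> t\<close>. Along this line
      \<open>u\<close> is \<open>V (\<rho> t)\<close>, which is differentiated twice at
      \<open>t = 0\<close>.\<close>
    define \<rho> where "\<rho> t = sqrt (r\<^sup>2 + t\<^sup>2)" for t
    define T where "T = {t. r\<^sup>2 + t\<^sup>2 < 1}"
    have T: "open T" unfolding T_def by (intro open_Collect_less continuous_intros)
    have T0: "0 \<in> T" using r by (simp add: T_def power_less_one_iff)
    have \<rho>_pos: "0 < r\<^sup>2 + t\<^sup>2" "0 < \<rho> t" for t using r by (simp_all add: \<rho>_def add_pos_nonneg)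
    have \<rho>_lt: "\<rho> t < 1" if "t \<in> T" for t using that by (simp add: \<rho>_def T_def)
    have orth: "e \<bullet> b = 0" "b \<bullet> e = 0" using b e by (auto simp: inner_Basis)
    have nrm: "norm (r *\<^sub>R e + t *\<^sub>R b) = \<rho> t" for t
      using orth e b by (simp add: norm_eq_sqrt_inner \<rho>_def inner_add_left inner_add_right power2_eq_square)
    have inT: "r *\<^sub>R e + t *\<^sub>R b \<in> ball 0 1" if "t \<in> T" for t using \<rho>_lt[OF that] nrm by simp
    have eq: "u (r *\<^sub>R e + t *\<^sub>R b) = V (\<rho> t)" if "t \<in> T" for t
      unfolding V_def using minimal_solution_radial[OF u inT[OF that]] nrm \<rho>_pos(2)[of t] ne by simp
    have \<rho>': "(\<rho> has_real_derivative t / \<rho> t) (at t)" for t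
      unfolding \<rho>_def using \<rho>_pos(1)[of t]
      by (auto intro!: derivative_eq_intros simp: divide_simps)
    have 1: "partial b u (r *\<^sub>R e + t *\<^sub>R b) = - w (\<rho> t) * (t / \<rho> t)" if t: "t \<in> T" for t
    proof (rule DERIV_unique)
      show "((\<lambda>t. u (r *\<^sub>R e + t *\<^sub>R b)) has_real_derivative partial b u (r *\<^sub>R e + t *\<^sub>R b)) (at t)"
        by (rule C2_on_line(1)[OF C2 b(1) inT[OF t]])
      have "((\<lambda>t. V (\<rho> t)) has_real_derivative - w (\<rho> t) * (t / \<rho> t)) (at t)"
        by (rule DERIV_chain2[OF V \<rho>']) (use \<rho>_pos(2)[of t] \<rho>_lt[OF t] in auto)
      then show "((\<lambda>t. u (r *\<^sub>R e + t *\<^sub>R b)) has_real_derivative - w (\<rho> t) * (t / \<rho> t)) (at t)"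
        by (rule has_field_derivative_transform_within_open[OF _ T t]) (simp add: eq)
    qed
    have \<rho>0: "\<rho> 0 = r" using r by (simp add: \<rho>_def)
    show ?thesis
    proof (rule DERIV_unique)
      show "((\<lambda>t. partial b u (r *\<^sub>R e + t *\<^sub>R b)) has_real_derivative partial b (partial b u) (r *\<^sub>R e)) (at 0)"
        using C2_on_line(2)[OF C2 b(1) inT[OF T0]] by simp
      have "((\<lambda>t. - w (\<rho> t)) has_real_derivative - (- partial e (partial e u) (r *\<^sub>R e) * (0 / \<rho> 0))) (at 0)"
        using w[of "\<rho> 0"] r by (intro DERIV_minus DERIV_chain2[OF _ \<rho>']) (simp add: \<rho>0)
      moreover have "((\<lambda>t. t / \<rho> t) has_real_derivative (1 * \<rho> 0 - 0 * (0 / \<rho> 0)) / (\<rho> 0 * \<rho> 0)) (at 0)"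
        using \<rho>_pos(2)[of 0] by (intro DERIV_divide DERIV_ident \<rho>') auto
      ultimately have "((\<lambda>t. - w (\<rho> t) * (t / \<rho> t)) has_real_derivative - w r / r) (at 0)"
        using r by (auto dest: DERIV_mult simp: \<rho>0)
      then show "((\<lambda>t. partial b u (r *\<^sub>R e + t *\<^sub>R b)) has_real_derivative - w r / r) (at 0)"
        by (rule has_field_derivative_transform_within_open[OF _ T T0]) (simp add: 1)
    qed
  qed
  have "radial_solution DIM('a) f lam V w"
    unfolding radial_solution_def
  proof (intro conjI ballI)
    show "continuous_on {0..1} V" unfolding V_def
      by (rule continuous_on_compose2[of "cball 0 1" u])
        (use cl ne in \<open>auto simp: classical_solution_def intro!: continuous_intros\<close>)
    show "V 1 = 0" using cl ne by (simp add: V_def classical_solution_def)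
    show "((\<lambda>r. r ^ (DIM('a) - 1) * w r) \<longlongrightarrow> 0) (at_right 0)"
    proof -
      \<comment> \<open>Since \<open>u\<close> is twice differentiable at the origin,
        \<open>w\<close> has a finite limit there, and the power of \<open>r\<close> makes the flux
        vanish.\<close>
      have w0: "(w \<longlongrightarrow> w 0) (at_right 0)"
        using DERIV_isCont[OF w[of 0]] by (simp add: isCont_def filterlim_at_split)
      have "((\<lambda>r::real. r ^ (DIM('a) - 1)) \<longlongrightarrow> 0 ^ (DIM('a) - 1)) (at_right 0)"
        by (intro tendsto_intros)
      from tendsto_mult[OF this w0] show ?thesis using dim by (simp add: power_0_left)
    qed
  next
    fix r :: real assume "r \<in> {0<..<1}"
    then have r: "0 < r" "r < 1" by auto
    show "0 < V r" using cl inb[of r] r by (simp add: V_def classical_solution_def)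
    show "(V has_real_derivative - w r) (at r)" using V r by simp
    have "laplacian u (r *\<^sub>R e) = partial e (partial e u) (r *\<^sub>R e) + (\<Sum>b\<in>Basis - {e}. - w r / r)"
      unfolding laplacian_def using e r by (simp add: sum.remove perp)
    then have "laplacian u (r *\<^sub>R e) = partial e (partial e u) (r *\<^sub>R e) - (DIM('a) - 1) * (w r / r)"
      using e by (simp add: card_Diff_singleton)
    moreover have "- laplacian u (r *\<^sub>R e) = lam * f (V r)"
      using cl inb[of r] r by (simp add: V_def classical_solution_def)
    ultimately have "- partial e (partial e u) (r *\<^sub>R e) = lam * f (V r) - (DIM('a) - 1) / r * w r"
      using dim by (simp add: of_nat_diff)
    then show "(w has_real_derivative lam * f (V r) - (real DIM('a) - 1) / r * w r) (at r)"
      using w[of r] r dim by (simp add: of_nat_diff)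
  qed
  then show ?thesis by (simp add: V_def[abs_def] w_def[abs_def])
qed

section \<open>Radial profiles as classical solutions\<close>

lemma norm_has_derivative:
  fixes x :: "'a::euclidean_space"
  assumes "x \<noteq> 0"
  shows "(norm has_derivative (\<lambda>h. x \<bullet> h / norm x)) (at x)"
  using has_derivative_norm[OF assms] by (simp add: sgn_div_norm inner_commute divide_inverse mult.commute)

context radial_problem
begin

text \<open>The quotient \<open>-V'/r\<close> with its limit filled in at 0. The gradient of
  \<open>V (norm x)\<close> is then \<open>- G (norm x)\<close> times \<open>x\<close>, without the
  singularity of the norm.\<close>

definition G :: "real \<Rightarrow> real" where
  "G r = (if r = 0 then lam * f (V 0) / real N else w r / r)"

lemma G_deriv:
  assumes "0 < r" "r < 1"
  shows "(G has_real_derivative (lam * f (V r) - real N * G r) / r) (at r)"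
proof -
  have "((\<lambda>r. w r / r) has_real_derivative
      ((lam * f (V r) - (real N - 1) / r * w r) * r - w r * 1) / (r * r)) (at r)"
    using assms by (intro DERIV_divide DERIV_ident w_deriv) auto
  then have "(G has_real_derivative
      ((lam * f (V r) - (real N - 1) / r * w r) * r - w r * 1) / (r * r)) (at r)"
    by (rule has_field_derivative_transform_within_open[of _ _ _ "{0<..}"])
      (use assms in \<open>auto simp: G_def\<close>)
  moreover have "((lam * f (V r) - (real N - 1) / r * w r) * r - w r * 1) / (r * r)
      = (lam * f (V r) - real N * G r) / r"
    using assms by (simp add: G_def divide_simps) (simp add: algebra_simps)
  ultimately show ?thesis by simp
qed

lemma f_V_cont:
  assumes "continuous_on {0..} f"
  shows "continuous_on {0..1} (\<lambda>r. f (V r))"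
  using V_nonneg by (intro continuous_on_compose2[OF assms V_cont]) auto

lemma G_cont:
  assumes f: "continuous_on {0..} f"
  shows "continuous_on {0..<1} G"
  unfolding continuous_on_eq_continuous_within
proof
  fix r :: real assume r: "r \<in> {0..<1}"
  show "continuous (at r within {0..<1}) G"
  proof (cases "r = 0")
    case False
    then show ?thesis using r G_deriv[of r] DERIV_isCont continuous_at_imp_continuous_at_within by force
  next
    case True
    have "(G \<longlongrightarrow> lam * f (V 0) / real N) (at 0 within {0..<1})"
    proof (rule tendsto_sandwich)
      have "continuous_on {0..<1} (\<lambda>r. f (V r))"
        using f_V_cont[OF f] by (rule continuous_on_subset) auto
      then show "((\<lambda>r. lam * f (V r) / real N) \<longlongrightarrow> lam * f (V 0) / real N) (at 0 within {0..<1})"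
        unfolding continuous_on_def using N by (auto intro!: tendsto_intros)
      show "((\<lambda>r. lam * f (V 0) / real N) \<longlongrightarrow> lam * f (V 0) / real N) (at 0 within {0..<1})"
        by simp
      show "\<forall>\<^sub>F r in at 0 within {0..<1}. lam * f (V r) / real N \<le> G r"
        "\<forall>\<^sub>F r in at 0 within {0..<1}. G r \<le> lam * f (V 0) / real N"
        unfolding eventually_at_filter using w_over_r_bounds by (auto simp: G_def)
    qed
    then show ?thesis using True by (simp add: continuous_within G_def)
  qed
qed

text \<open>A quadratic bound on the increment, from \<open>w x \<le> K * x\<close>; it makes
  \<open>V (norm x)\<close> differentiable at the origin with zero gradient.\<close>

lemma V_diff_le:
  assumes "0 \<le> r" "r < 1"
  shows "V 0 - V r \<le> lam * f (V 0) / real N * r\<^sup>2"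
proof -
  define K where "K = lam * f (V 0) / real N"
  have "V 0 + K * 0\<^sup>2 \<le> V r + K * r\<^sup>2"
  proof (rule DERIV_nonneg_imp_increasing_open[of 0 r "\<lambda>r. V r + K * r\<^sup>2"])
    fix x assume x: "0 < x" "x < r"
    have "w x \<le> K * x"
      using w_over_r_bounds(2)[of x] x assms by (simp add: K_def[symmetric] pos_divide_le_eq)
    moreover have "0 < w x" using w_pos x assms by simp
    ultimately have "0 \<le> - w x + K * (2 * x)" by linarith
    then show "\<exists>y. ((\<lambda>r. V r + K * r\<^sup>2) has_real_derivative y) (at x) \<and> 0 \<le> y"
      using x assms by (intro exI[of _ "- w x + K * (2 * x)"]) (auto intro!: derivative_eq_intros V_deriv)
  next
    show "continuous_on {0..r} (\<lambda>r. V r + K * r\<^sup>2)"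
      using assms by (intro continuous_intros continuous_on_subset[OF V_cont]) auto
  qed (use assms in simp)
  then show ?thesis by (simp add: K_def)
qed

lemma V_norm_has_derivative:
  fixes x :: "'a::euclidean_space"
  assumes x: "norm x < 1"
  shows "((\<lambda>x. V (norm x)) has_derivative (\<lambda>h. - G (norm x) * (x \<bullet> h))) (at x)"
proof (cases "x = 0")
  case False
  have "((\<lambda>x. V (norm x)) has_derivative (\<lambda>h. - w (norm x) * (x \<bullet> h / norm x))) (at x)"
    by (rule has_derivative_compose[OF norm_has_derivative[OF False] V_deriv[unfolded has_field_derivative_def]])
      (use False x in auto)
  then show ?thesis using False by (simp add: G_def)
next
  case True
  define K where "K = lam * f (V 0) / real N"
  have "((\<lambda>h::'a. (V (norm h) - V 0) / norm h) \<longlongrightarrow> 0) (at 0)"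
  proof (rule Lim_null_comparison)
    have "norm ((V (norm h) - V 0) / norm h) \<le> K * norm h" if "dist h 0 < 1" "h \<noteq> 0" for h :: 'a
      using V_diff_le[of "norm h"] V_antimono[of 0 "norm h"] that
      by (simp add: K_def[symmetric] divide_le_eq power2_eq_square mult.assoc)
    then show "\<forall>\<^sub>F h::'a in at 0. norm ((V (norm h) - V 0) / norm h) \<le> K * norm h"
      unfolding eventually_at by (intro exI[of _ 1]) auto
    show "((\<lambda>h::'a. K * norm h) \<longlongrightarrow> 0) (at 0)"
      by (auto intro!: tendsto_eq_intros)
  qed
  then have "((\<lambda>h::'a. norm (V (norm h) - V 0) / norm h) \<longlongrightarrow> 0) (at 0)"
    by (drule_tac tendsto_norm_zero) (simp add: abs_divide)
  then show ?thesis using True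
    by (simp add: has_derivative_at)
qed

text \<open>One formula serves all points: at \<open>x = 0\<close> its last summand vanishes,
  division by 0 being 0. There the claim reduces to the continuity of \<open>G\<close>, because the
  factor \<open>x \<bullet> b\<close> is itself linear.\<close>

lemma G_norm_has_derivative:
  fixes x b :: "'a::euclidean_space"
  assumes f: "continuous_on {0..} f" and x: "norm x < 1"
  shows "((\<lambda>x. - (G (norm x) * (x \<bullet> b))) has_derivative
     (\<lambda>h. - (G (norm x) * (h \<bullet> b) +
        (lam * f (V (norm x)) - real N * G (norm x)) / (norm x)\<^sup>2 * (x \<bullet> h) * (x \<bullet> b)))) (at x)"
proof (cases "x = 0")
  case False
  have g: "((\<lambda>x. G (norm x)) has_derivative
      (\<lambda>h. (lam * f (V (norm x)) - real N * G (norm x)) / norm x * (x \<bullet> h / norm x))) (at x)"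
    by (rule has_derivative_compose[OF norm_has_derivative[OF False] G_deriv[unfolded has_field_derivative_def]])
      (use False x in auto)
  show ?thesis
    by (rule derivative_eq_intros g refl | rule ext)+ (simp add: power2_eq_square algebra_simps diff_divide_distrib)
next
  case True
  have bn: "\<bar>h \<bullet> b\<bar> / norm h \<le> norm b" for h
    using Cauchy_Schwarz_ineq2[of h b] by (cases "h = 0") (simp_all add: divide_le_eq mult.commute)
  have "((\<lambda>h::'a. G (norm h)) \<longlongrightarrow> G 0) (at 0)"
  proof -
    have "continuous_on (ball 0 1) (\<lambda>h::'a. G (norm h))"
      by (intro continuous_on_compose2[OF G_cont[OF f]] continuous_intros) auto
    then have "isCont (\<lambda>h::'a. G (norm h)) 0"
      by (simp add: continuous_on_eq_continuous_at)
    then show ?thesis by (simp add: isCont_def)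
  qed
  then have "((\<lambda>h::'a. \<bar>G (norm h) - G 0\<bar> * norm b) \<longlongrightarrow> \<bar>G 0 - G 0\<bar> * norm b) (at 0)"
    by (intro tendsto_intros)
  then have "((\<lambda>h::'a. \<bar>G (norm h) - G 0\<bar> * norm b) \<longlongrightarrow> 0) (at 0)" by simp
  then have "((\<lambda>h. norm (- (G (norm h) * (h \<bullet> b)) + G 0 * (h \<bullet> b)) / norm h) \<longlongrightarrow> 0) (at 0)"
  proof (rule Lim_null_comparison[rotated])
    have "norm (norm (- (G (norm h) * (h \<bullet> b)) + G 0 * (h \<bullet> b)) / norm h) \<le> \<bar>G (norm h) - G 0\<bar> * norm b" for h
    proof -
      have *: "- (G (norm h) * (h \<bullet> b)) + G 0 * (h \<bullet> b) = - ((G (norm h) - G 0) * (h \<bullet> b))"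
        by (simp add: algebra_simps)
      have "norm (norm (- (G (norm h) * (h \<bullet> b)) + G 0 * (h \<bullet> b)) / norm h)
          = \<bar>G (norm h) - G 0\<bar> * (\<bar>h \<bullet> b\<bar> / norm h)"
        unfolding * by (simp add: abs_mult)
      also have "\<dots> \<le> \<bar>G (norm h) - G 0\<bar> * norm b" by (intro mult_left_mono bn) simp
      finally show ?thesis .
    qed
    then show "\<forall>\<^sub>F h in at 0. norm (norm (- (G (norm h) * (h \<bullet> b)) + G 0 * (h \<bullet> b)) / norm h)
        \<le> \<bar>G (norm h) - G 0\<bar> * norm b" by simp
  qed
  moreover have "bounded_linear (\<lambda>h. - (G 0 * (h \<bullet> b)))"
    by (intro bounded_linear_minus bounded_linear_mult_right bounded_linear_compose[OF bounded_linear_mult_right] bounded_linear_inner_left)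
  ultimately show ?thesis using True
    by (simp add: has_derivative_at)
qed

text \<open>The product of two coordinates is at most \<open>(norm x)\<^sup>2\<close>, so the term
  is bounded by its numerator. The numerator tends to 0 at the origin by the choice of
  \<open>G 0\<close>.\<close>

lemma hessian_term_cont:
  fixes b c :: "'a::euclidean_space"
  assumes f: "continuous_on {0..} f" and bc: "b \<in> Basis" "c \<in> Basis"
  shows "continuous_on (ball 0 1)
    (\<lambda>x. (lam * f (V (norm x)) - real N * G (norm x)) / (norm x)\<^sup>2 * (x \<bullet> c) * (x \<bullet> b))"
proof -
  define R where "R x = lam * f (V (norm x)) - real N * G (norm x)" for x :: 'a
  have "continuous_on (ball 0 1) (\<lambda>h::'a. G (norm h))"
    by (intro continuous_on_compose2[OF G_cont[OF f]] continuous_intros) auto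
  moreover have "continuous_on (ball 0 1) (\<lambda>h::'a. f (V (norm h)))"
    by (intro continuous_on_compose2[OF f_V_cont[OF f]] continuous_intros) auto
  ultimately have R: "continuous_on (ball 0 1) R"
    unfolding R_def by (intro continuous_intros)
  have "isCont (\<lambda>x. R x / (norm x)\<^sup>2 * (x \<bullet> c) * (x \<bullet> b)) x" if x: "x \<in> ball 0 1" for x
  proof (cases "x = 0")
    case False
    have "isCont R x" using R x by (simp add: continuous_on_eq_continuous_at)
    then show ?thesis using False by (intro continuous_intros) auto
  next
    case True
    have "isCont R 0" using R by (simp add: continuous_on_eq_continuous_at)
    moreover have "R 0 = 0" using N by (simp add: R_def G_def)
    ultimately have "((\<lambda>x. \<bar>R x\<bar>) \<longlongrightarrow> 0) (at 0)"
      using tendsto_rabs_zero[of R "at 0"] by (simp add: isCont_def)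
    then have "((\<lambda>x. R x / (norm x)\<^sup>2 * (x \<bullet> c) * (x \<bullet> b)) \<longlongrightarrow> 0) (at 0)"
    proof (rule Lim_null_comparison[rotated])
      have "norm (R x / (norm x)\<^sup>2 * (x \<bullet> c) * (x \<bullet> b)) \<le> \<bar>R x\<bar>" for x
      proof (cases "x = 0")
        case False
        have "\<bar>x \<bullet> c\<bar> \<le> norm x" "\<bar>x \<bullet> b\<bar> \<le> norm x" using bc Basis_le_norm by auto
        then have "\<bar>x \<bullet> c\<bar> * \<bar>x \<bullet> b\<bar> \<le> (norm x)\<^sup>2"
          unfolding power2_eq_square by (intro mult_mono) auto
        then have "\<bar>R x\<bar> * (\<bar>x \<bullet> c\<bar> * \<bar>x \<bullet> b\<bar>) \<le> \<bar>R x\<bar> * (norm x)\<^sup>2" by (intro mult_left_mono) auto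
        then show ?thesis using False by (simp add: abs_mult divide_le_eq mult.assoc)
      qed simp
      then show "\<forall>\<^sub>F x in at 0. norm (R x / (norm x)\<^sup>2 * (x \<bullet> c) * (x \<bullet> b)) \<le> \<bar>R x\<bar>" by simp
    qed
    then show ?thesis using True by (simp add: isCont_def)
  qed
  then show ?thesis by (simp add: continuous_on_eq_continuous_at R_def)
qed

text \<open>Converse of \<open>minimal_solution_profile\<close>: a profile obtained from the radial
  equation becomes a competitor in the definition of the minimal solution.\<close>

lemma classical_solution_radial:
  assumes f: "continuous_on {0..} f" and dim: "N = DIM('a::euclidean_space)"
  shows "classical_solution (ball (0::'a) 1) f lam (\<lambda>x. V (norm x))"
proof -
  define P :: "'a \<Rightarrow> 'a \<Rightarrow> real" where "P b x = - (G (norm x) * (x \<bullet> b))" for b x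
  define R where "R x = (lam * f (V (norm x)) - real N * G (norm x)) / (norm x)\<^sup>2" for x :: 'a
  define Q :: "'a \<Rightarrow> 'a \<Rightarrow> 'a \<Rightarrow> real" where
    "Q b c x = - (G (norm x) * (c \<bullet> b) + R x * (x \<bullet> c) * (x \<bullet> b))" for b c x
  have expand: "(\<Sum>b\<in>Basis. (h \<bullet> b) * (x \<bullet> b)) = x \<bullet> h" for x h :: 'a
    by (simp add: euclidean_inner[of x h] mult.commute)
  have P: "((\<lambda>x. V (norm x)) has_derivative (\<lambda>h. \<Sum>b\<in>Basis. (h \<bullet> b) * P b x)) (at x)"
    if "x \<in> ball 0 1" for x :: 'a
  proof -
    have "(\<Sum>b\<in>Basis. (h \<bullet> b) * P b x) = - G (norm x) * (x \<bullet> h)" for h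
    proof -
      have "(\<Sum>b\<in>Basis. (h \<bullet> b) * P b x) = - G (norm x) * (\<Sum>b\<in>Basis. (h \<bullet> b) * (x \<bullet> b))"
        unfolding sum_distrib_left P_def by (intro sum.cong refl) (simp add: algebra_simps)
      then show ?thesis by (simp only: expand)
    qed
    then show ?thesis using V_norm_has_derivative[of x] that by simp
  qed
  have Q: "(P b has_derivative (\<lambda>h. \<Sum>c\<in>Basis. (h \<bullet> c) * Q b c x)) (at x)"
    if "x \<in> ball 0 1" "b \<in> Basis" for x b :: 'a
  proof -
    have "(\<Sum>c\<in>Basis. (h \<bullet> c) * Q b c x) = - (G (norm x) * (h \<bullet> b) + R x * (x \<bullet> h) * (x \<bullet> b))" for h
    proof -
      have "(\<Sum>c\<in>Basis. (h \<bullet> c) * Q b c x) =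
         - (G (norm x) * (\<Sum>c\<in>Basis. (h \<bullet> c) * (b \<bullet> c)) + R x * (x \<bullet> b) * (\<Sum>c\<in>Basis. (h \<bullet> c) * (x \<bullet> c)))"
        unfolding Q_def sum_distrib_left sum.distrib[symmetric] sum_negf[symmetric]
        by (intro sum.cong refl) (simp add: algebra_simps inner_commute)
      then show ?thesis unfolding expand by (simp add: inner_commute)
    qed
    then show ?thesis using G_norm_has_derivative[OF f, of x b] that
      by (simp add: R_def P_def[abs_def])
  qed
  have Q_cont: "continuous_on (ball 0 1) (Q b c)" if "b \<in> Basis" "c \<in> Basis" for b c
    unfolding Q_def R_def
    by (intro continuous_intros hessian_term_cont[OF f that] continuous_on_compose2[OF G_cont[OF f]]) auto
  show ?thesis unfolding classical_solution_def
  proof (intro conjI ballI)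
    show "continuous_on (closure (ball 0 1)) (\<lambda>x::'a. V (norm x))"
      by (intro continuous_on_compose2[OF V_cont] continuous_intros) auto
    show "C2_on (ball 0 1) (\<lambda>x::'a. V (norm x))"
      by (rule C2_onI(1)[where S = "ball 0 1" and P = P and Q = Q]) (use P Q Q_cont in auto)
  next
    fix x :: 'a assume x: "x \<in> ball 0 1"
    have "laplacian (\<lambda>x. V (norm x)) x = (\<Sum>b\<in>Basis. Q b b x)"
      by (rule C2_onI(4)[where S = "ball 0 1" and P = P]) (use P Q Q_cont x in auto)
    also have "\<dots> = - (real N * G (norm x) + R x * (\<Sum>b\<in>Basis. (x \<bullet> b) * (x \<bullet> b)))"
      unfolding Q_def sum_negf sum.distrib sum_distrib_left dim by (simp add: mult.assoc)
    also have "\<dots> = - (real N * G (norm x) + R x * (norm x)\<^sup>2)"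
      unfolding expand by (simp add: power2_norm_eq_inner)
    also have "\<dots> = - (lam * f (V (norm x)))"
      using N by (cases "x = 0") (simp_all add: R_def G_def)
    finally show "- laplacian (\<lambda>x. V (norm x)) x = lam * f (V (norm x))" by simp
    show "0 < V (norm x)"
    proof -
      \<comment> \<open>\<open>V_pos\<close> excludes the origin, so positivity is taken from a
        radius strictly between \<open>norm x\<close> and 1.\<close>
      define s where "s = (norm x + 1) / 2"
      have "norm x \<le> s" "0 < s" "s < 1" using x by (auto simp: s_def add_nonneg_pos)
      then have "V s \<le> V (norm x)" "0 < V s" using V_antimono[of "norm x" s] V_pos[of s] by auto
      then show ?thesis by simp
    qed
  next
    fix x :: 'a assume "x \<in> frontier (ball 0 1)"
    then show "V (norm x) = 0" using V_1 by simp
  qed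
qed

end

section \<open>Solutions below a supersolution\<close>

locale radial_operator =
  fixes N :: nat and f :: "real \<Rightarrow> real" and lam :: real
  assumes N: "N \<ge> 3" and lam: "lam > 0" and f_mono: "mono_on {0..} f" and f_pos: "f 0 > 0"
    and f_cont: "continuous_on {0..} f"
begin

text \<open>No continuity is demanded, so the class is stable under pointwise infima; monotonicity
  still provides integrability.\<close>

definition admissible :: "(real \<Rightarrow> real) \<Rightarrow> bool" where
  "admissible z \<longleftrightarrow> (\<forall>r s. 0 \<le> r \<longrightarrow> r \<le> s \<longrightarrow> s \<le> 1 \<longrightarrow> z s \<le> z r) \<and> (\<forall>r\<in>{0..1}. 0 \<le> z r)"

definition flux :: "(real \<Rightarrow> real) \<Rightarrow> real \<Rightarrow> real" where
  "flux z t = integral {0..t} (\<lambda>s. lam * s ^ (N - 1) * f (z s))"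

text \<open>\<open>T z\<close> integrates the radial equation with source
  \<open>lam * f (z r)\<close> and boundary value 0 at \<open>r = 1\<close>. At \<open>t = 0\<close>
  the quotient is 0 by the convention on division, which is also its limit.\<close>

definition T :: "(real \<Rightarrow> real) \<Rightarrow> real \<Rightarrow> real" where
  "T z r = integral {r..1} (\<lambda>t. flux z t / t ^ (N - 1))"

section \<open>Properties of the radial integral operator on decreasing functions\<close>

lemma admissible_f:
  assumes "admissible z" "0 \<le> r" "r \<le> s" "s \<le> 1"
  shows "f (z s) \<le> f (z r)"
  by (rule mono_onD[OF f_mono]) (use assms in \<open>auto simp: admissible_def\<close>)

lemma f_ge: "0 \<le> t \<Longrightarrow> f 0 \<le> f t"
  by (rule mono_onD[OF f_mono]) auto

text \<open>For a possibly discontinuous \<open>z\<close>, the second mean value theorem gives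
  integrability of a monotone function times a continuous one. It asks for an increasing factor,
  hence the sign change.\<close>

lemma integrable:
  assumes z: "admissible z" and t: "0 \<le> t" "t \<le> 1"
  shows "(\<lambda>s. lam * s ^ (N - 1) * f (z s)) integrable_on {0..t}"
proof -
  have "(\<lambda>s. lam * s ^ (N - 1)) integrable_on {0..t}"
    by (intro integrable_continuous_real continuous_intros)
  moreover have "- f (z x) \<le> - f (z y)" if "0 \<le> x" "x \<le> y" "y \<le> t" for x y
    using admissible_f[OF z, of x y] that t by simp
  ultimately obtain c where
    "((\<lambda>s. - f (z s) * (lam * s ^ (N - 1))) has_integral
      (- f (z 0) * integral {0..c} (\<lambda>s. lam * s ^ (N - 1)) +
       - f (z t) * integral {c..t} (\<lambda>s. lam * s ^ (N - 1)))) {0..t}"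
    using second_mean_value_theorem_full[of "\<lambda>s. lam * s ^ (N - 1)" 0 t "\<lambda>s. - f (z s)"] t by metis
  then have "(\<lambda>s. - f (z s) * (lam * s ^ (N - 1))) integrable_on {0..t}" by blast
  then have "(\<lambda>s. - (- f (z s) * (lam * s ^ (N - 1)))) integrable_on {0..t}" by (rule integrable_neg)
  then show ?thesis by (simp add: mult_ac)
qed

lemma power_integral:
  assumes "0 \<le> t"
  shows "((\<lambda>s. lam * s ^ (N - 1) * A) has_integral lam * A * t ^ N / real N) {0..t}"
proof -
  have "((\<lambda>s. lam * s ^ (N - 1) * A) has_integral lam * A * t ^ N / real N - lam * A * 0 ^ N / real N) {0..t}"
  proof (rule fundamental_theorem_of_calculus[OF assms])
    fix s
    have "((\<lambda>s. lam * A * s ^ N / real N) has_real_derivative lam * s ^ (N - 1) * A) (at s within {0..t})"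
      using N by (auto intro!: derivative_eq_intros)
    then show "((\<lambda>s. lam * A * s ^ N / real N) has_vector_derivative lam * s ^ (N - 1) * A) (at s within {0..t})"
      by (simp add: has_real_derivative_iff_has_vector_derivative)
  qed
  then show ?thesis using N by (simp add: power_0_left)
qed

lemma flux_bounds:
  assumes z: "admissible z" and t: "0 \<le> t" "t \<le> 1"
  shows "lam * f 0 * t ^ N / real N \<le> flux z t" and "flux z t \<le> lam * f (z 0) * t ^ N / real N"
proof -
  note int = integrable_integral[OF integrable[OF z t], folded flux_def]
  show "lam * f 0 * t ^ N / real N \<le> flux z t"
  proof (rule has_integral_le[OF power_integral[OF t(1)] int])
    fix s assume "s \<in> {0..t}"
    then show "lam * s ^ (N - 1) * f 0 \<le> lam * s ^ (N - 1) * f (z s)"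
      using z t lam by (intro mult_left_mono f_ge) (auto simp: admissible_def)
  qed
  show "flux z t \<le> lam * f (z 0) * t ^ N / real N"
  proof (rule has_integral_le[OF int power_integral[OF t(1)]])
    fix s assume "s \<in> {0..t}"
    then show "lam * s ^ (N - 1) * f (z s) \<le> lam * s ^ (N - 1) * f (z 0)"
      using t lam by (intro mult_left_mono admissible_f[OF z]) auto
  qed
qed

lemma flux_pos:
  assumes "admissible z" "0 < t" "t \<le> 1"
  shows "0 < flux z t"
proof -
  have "0 < lam * f 0 * t ^ N / real N" using lam f_pos assms N by simp
  also have "\<dots> \<le> flux z t" using assms by (intro flux_bounds) auto
  finally show ?thesis .
qed

lemma flux_cont: "admissible z \<Longrightarrow> continuous_on {0..1} (flux z)"
  unfolding flux_def by (intro indefinite_integral_continuous_1 integrable) auto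

lemma flux_deriv:
  assumes z: "admissible z" "continuous_on {0..1} z" and r: "0 < r" "r < 1"
  shows "(flux z has_real_derivative lam * r ^ (N - 1) * f (z r)) (at r)"
proof -
  have cont: "continuous_on {0..1} (\<lambda>s. lam * s ^ (N - 1) * f (z s))"
    by (intro continuous_intros continuous_on_compose2[OF f_cont z(2)])
      (use z(1) in \<open>auto simp: admissible_def\<close>)
  have "(flux z has_real_derivative lam * r ^ (N - 1) * f (z r)) (at r within {0..1})"
    unfolding flux_def using integral_has_real_derivative[OF cont] r by simp
  moreover have "at r within {0..1} = at r"
    using r by (intro at_within_interior) simp
  ultimately show ?thesis by simp
qed

lemma flux_lim:
  assumes "admissible z"
  shows "(flux z \<longlongrightarrow> 0) (at_right 0)"
proof -
  have "(flux z \<longlongrightarrow> flux z 0) (at 0 within {0..1})"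
    using flux_cont[OF assms] by (simp add: continuous_on_def)
  moreover have "flux z 0 = 0" by (simp add: flux_def)
  moreover have "at 0 within {0..1} = at_right (0::real)"
    by (rule at_within_Icc_at_right) simp
  ultimately show ?thesis by simp
qed

lemma slope_nonneg:
  assumes "admissible z" "0 \<le> t" "t \<le> 1"
  shows "0 \<le> flux z t / t ^ (N - 1)"
proof (cases "t = 0")
  case True
  then show ?thesis using N by (simp add: power_0_left)
next
  case False
  then show ?thesis using flux_pos[of z t] assms by simp
qed

lemma slope_le:
  assumes z: "admissible z" and t: "0 \<le> t" "t \<le> 1"
  shows "flux z t / t ^ (N - 1) \<le> lam * f (z 0) / real N * t"
proof (cases "t = 0")
  case True
  then show ?thesis using N by (simp add: power_0_left)
next
  case False
  define m where "m = N - 1"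
  have m: "N = Suc m" using N by (simp add: m_def)
  have "flux z t \<le> lam * f (z 0) / real N * t * t ^ m"
    using flux_bounds(2)[OF z t] by (simp add: m mult_ac)
  then show ?thesis using False t by (simp add: m divide_le_eq)
qed

lemma slope_cont:
  assumes z: "admissible z"
  shows "continuous_on {0..1} (\<lambda>t. flux z t / t ^ (N - 1))"
  unfolding continuous_on_eq_continuous_within
proof
  fix t :: real assume t: "t \<in> {0..1}"
  show "continuous (at t within {0..1}) (\<lambda>t. flux z t / t ^ (N - 1))"
  proof (cases "t = 0")
    case False
    have "continuous (at t within {0..1}) (flux z)"
      using flux_cont[OF z] t by (simp add: continuous_on_eq_continuous_within)
    then show ?thesis using False by (intro continuous_intros) auto
  next
    case True
    have "((\<lambda>t. flux z t / t ^ (N - 1)) \<longlongrightarrow> 0) (at 0 within {0..1})"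
    proof (rule tendsto_sandwich[where f = "\<lambda>_. 0" and h = "\<lambda>t. lam * f (z 0) / real N * t"])
      show "((\<lambda>t. lam * f (z 0) / real N * t) \<longlongrightarrow> 0) (at 0 within {0..1})"
        using N by (auto intro!: tendsto_eq_intros)
      show "\<forall>\<^sub>F t in at 0 within {0..1}. 0 \<le> flux z t / t ^ (N - 1)"
        unfolding eventually_at_filter using slope_nonneg[OF z] by simp
      show "\<forall>\<^sub>F t in at 0 within {0..1}. flux z t / t ^ (N - 1) \<le> lam * f (z 0) / real N * t"
        unfolding eventually_at_filter using slope_le[OF z] by (intro always_eventually) auto
    qed simp
    then show ?thesis using True N by (simp add: continuous_within power_0_left)
  qed
qed

lemma slope_integrable:
  assumes "admissible z" "0 \<le> r"
  shows "(\<lambda>t. flux z t / t ^ (N - 1)) integrable_on {r..1}"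
  by (rule integrable_continuous_real, rule continuous_on_subset[OF slope_cont]) (use assms in auto)

lemma T_cont: "admissible z \<Longrightarrow> continuous_on {0..1} (T z)"
  unfolding T_def by (intro indefinite_integral_continuous_1' slope_integrable) auto

lemma T_1: "T z 1 = 0"
  by (simp add: T_def)

lemma T_deriv:
  assumes z: "admissible z" and r: "0 < r" "r < 1"
  shows "(T z has_real_derivative - (flux z r / r ^ (N - 1))) (at r)"
proof -
  have "(T z has_real_derivative - (flux z r / r ^ (N - 1))) (at r within {0..1})"
    unfolding T_def using integral_has_real_derivative'[OF slope_cont[OF z]] r by simp
  moreover have "at r within {0..1} = at r"
    using r by (intro at_within_interior) simp
  ultimately show ?thesis by simp
qed

lemma T_antimono:
  assumes z: "admissible z" and r: "0 \<le> r" "r \<le> s" "s \<le> 1"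
  shows "T z s \<le> T z r"
  unfolding T_def
  by (rule integral_subset_le) (use r slope_integrable[OF z] slope_nonneg[OF z] in auto)

lemma admissible_T: "admissible z \<Longrightarrow> admissible (T z)"
  unfolding admissible_def[of "T z"] using T_antimono[of z] T_1[of z]
  by (metis atLeastAtMost_iff order_refl)

lemma T_mono:
  assumes z: "admissible z" "admissible y" and le: "\<And>r. 0 \<le> r \<Longrightarrow> r \<le> 1 \<Longrightarrow> z r \<le> y r"
    and r: "0 \<le> r"
  shows "T z r \<le> T y r"
  unfolding T_def
proof (rule integral_le[OF slope_integrable[OF z(1) r] slope_integrable[OF z(2) r]])
  fix t assume "t \<in> {r..1}"
  then have t: "0 \<le> t" "t \<le> 1" using r by auto
  have "flux z t \<le> flux y t"
    unfolding flux_def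
  proof (rule integral_le[OF integrable[OF z(1) t] integrable[OF z(2) t]])
    fix s assume "s \<in> {0..t}"
    then have s: "0 \<le> s" "s \<le> 1" using t by auto
    then have "0 \<le> z s" "0 \<le> y s" using z by (auto simp: admissible_def)
    then have "f (z s) \<le> f (y s)" using le[OF s] by (intro mono_onD[OF f_mono]) auto
    then show "lam * s ^ (N - 1) * f (z s) \<le> lam * s ^ (N - 1) * f (y s)"
      using lam s by (intro mult_left_mono) auto
  qed
  then show "flux z t / t ^ (N - 1) \<le> flux y t / t ^ (N - 1)"
    using t by (intro divide_right_mono) auto
qed

text \<open>Knaster--Tarski: the pointwise infimum of all decreasing supersolutions is a fixed point.\<close>

lemma fixed_point:
  assumes V: "admissible V" and super: "\<And>r. 0 \<le> r \<Longrightarrow> r \<le> 1 \<Longrightarrow> T V r \<le> V r"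
  obtains v where "admissible v" and "\<And>r. 0 \<le> r \<Longrightarrow> r \<le> 1 \<Longrightarrow> v r = T v r"
    and "\<And>r. 0 \<le> r \<Longrightarrow> r \<le> 1 \<Longrightarrow> v r \<le> V r"
proof -
  define Z where "Z = {z. admissible z \<and> (\<forall>r. 0 \<le> r \<longrightarrow> r \<le> 1 \<longrightarrow> T z r \<le> z r)}"
  define v where "v r = (INF z\<in>Z. z r)" for r
  have VZ: "V \<in> Z" using V super by (simp add: Z_def)
  have v_le: "v r \<le> z r" if "z \<in> Z" "0 \<le> r" "r \<le> 1" for z r
    unfolding v_def by (rule cINF_lower[OF bdd_belowI[of _ 0]]) (use that in \<open>auto simp: Z_def admissible_def\<close>)
  have v_ge: "c \<le> v r" if "\<And>z. z \<in> Z \<Longrightarrow> c \<le> z r" for c r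
    unfolding v_def using VZ that by (intro cINF_greatest) auto
  have adm: "admissible v"
    unfolding admissible_def
  proof (intro conjI allI impI ballI)
    fix r s :: real assume rs: "0 \<le> r" "r \<le> s" "s \<le> 1"
    show "v s \<le> v r"
    proof (rule v_ge)
      fix z assume z: "z \<in> Z"
      have "v s \<le> z s" using v_le[OF z] rs by simp
      also have "\<dots> \<le> z r" using z rs by (simp add: Z_def admissible_def)
      finally show "v s \<le> z r" .
    qed
  next
    fix r :: real assume "r \<in> {0..1}"
    then show "0 \<le> v r" by (intro v_ge) (auto simp: Z_def admissible_def)
  qed
  have Tv_le: "T v r \<le> v r" if r: "0 \<le> r" "r \<le> 1" for r
  proof (rule v_ge)
    fix z assume z: "z \<in> Z"
    have "T v r \<le> T z r" using z adm r v_le[OF z] by (intro T_mono) (auto simp: Z_def)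
    also have "\<dots> \<le> z r" using z r by (simp add: Z_def)
    finally show "T v r \<le> z r" .
  qed
  \<comment> \<open>By monotonicity \<open>T v\<close> is again a supersolution, so it competes in
    the infimum; this gives the missing inequality \<open>v \<le> T v\<close>.\<close>
  have "T v \<in> Z"
    unfolding Z_def using admissible_T[OF adm] T_mono[OF admissible_T[OF adm] adm Tv_le] by simp
  then have "v r = T v r" if "0 \<le> r" "r \<le> 1" for r
    using v_le[of "T v" r] Tv_le[of r] that by simp
  then show ?thesis using that[of v] adm v_le[OF VZ] by simp
qed

text \<open>Regularity is gained from the equation: \<open>v = T v\<close> makes the merely monotone
  \<open>v\<close> continuous, after which the flux can be differentiated.\<close>

lemma radial_solution_fixed_point:
  assumes v: "admissible v" and fp: "\<And>r. 0 \<le> r \<Longrightarrow> r \<le> 1 \<Longrightarrow> v r = T v r"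
  shows "radial_solution N f lam v (\<lambda>r. flux v r / r ^ (N - 1))"
proof -
  have v_cont: "continuous_on {0..1} v"
    by (rule continuous_on_eq[OF T_cont[OF v]]) (use fp in auto)
  have v_deriv: "(v has_real_derivative - (flux v r / r ^ (N - 1))) (at r)" if "0 < r" "r < 1" for r
    by (rule has_field_derivative_transform_within_open[OF T_deriv[OF v that] open_greaterThanLessThan[of 0 1]])
      (use that fp in auto)
  define m where "m = N - 2"
  have m: "N - 1 = Suc m" "real N = real m + 2" using N by (auto simp: m_def)
  show ?thesis unfolding radial_solution_def
  proof (intro conjI ballI v_cont)
    show "v 1 = 0" using fp[of 1] T_1 by simp
    show "((\<lambda>r. r ^ (N - 1) * (flux v r / r ^ (N - 1))) \<longlongrightarrow> 0) (at_right 0)"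
      by (rule Lim_transform_eventually[OF flux_lim[OF v]]) (simp add: eventually_at_filter)
  next
    fix r :: real assume "r \<in> {0<..<1}"
    then have r: "0 < r" "r < 1" by auto
    show "(v has_real_derivative - (flux v r / r ^ (N - 1))) (at r)" using v_deriv[OF r] .
    have "v 1 < v r"
    proof (rule DERIV_neg_imp_decreasing_open[OF r(2)])
      fix x assume x: "r < x" "x < 1"
      then have "0 < flux v x / x ^ (N - 1)" using flux_pos[OF v, of x] r by simp
      then show "\<exists>y. (v has_real_derivative y) (at x) \<and> y < 0"
        using v_deriv[of x] x r by (intro exI[of _ "- (flux v x / x ^ (N - 1))"]) auto
    next
      show "continuous_on {r..1} v" using v_cont by (rule continuous_on_subset) (use r in auto)
    qed
    then show "0 < v r" using fp[of 1] T_1 by simp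
    have "((\<lambda>r. flux v r / r ^ (N - 1)) has_real_derivative
        (lam * r ^ (N - 1) * f (v r) * r ^ (N - 1) - flux v r * (real (N - 1) * r ^ (N - 1 - 1)))
          / (r ^ (N - 1) * r ^ (N - 1))) (at r)"
      using r by (intro DERIV_divide flux_deriv v v_cont) (auto intro!: derivative_eq_intros)
    moreover have "(lam * r ^ (N - 1) * f (v r) * r ^ (N - 1) - flux v r * (real (N - 1) * r ^ (N - 1 - 1)))
          / (r ^ (N - 1) * r ^ (N - 1))
        = lam * f (v r) - (real N - 1) / r * (flux v r / r ^ (N - 1))"
      using r unfolding m by (simp add: field_simps)
    ultimately show "((\<lambda>r. flux v r / r ^ (N - 1)) has_real_derivative
        lam * f (v r) - (real N - 1) / r * (flux v r / r ^ (N - 1))) (at r)" by simp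
  qed
qed

text \<open>A solution for the larger parameter is a supersolution for the smaller one. Its flux
  dominates \<open>flux V\<close>, and integrating the slopes from the common boundary value 0 gives
  \<open>T V \<le> V\<close>.\<close>

lemma radial_solution_below:
  assumes V: "radial_solution N f mu V w" and mu: "lam < mu"
  obtains v w' where "radial_solution N f lam v w'" and "\<And>r. 0 \<le> r \<Longrightarrow> r \<le> 1 \<Longrightarrow> v r \<le> V r"
proof -
  interpret V: radial_problem N f mu V w
    by unfold_locales (use N lam mu f_mono f_pos V in auto)
  have adm: "admissible V"
    using V.V_antimono V.V_nonneg by (auto simp: admissible_def)
  have slope: "flux V r / r ^ (N - 1) \<le> w r" if r: "0 < r" "r < 1" for r
  proof -
    have "0 \<le> r ^ (N - 1) * w r - flux V r"
    proof (rule nonneg_of_deriv_nonneg[OF r(1)])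
      show "((\<lambda>r. r ^ (N - 1) * w r - flux V r) \<longlongrightarrow> 0) (at_right 0)"
        using tendsto_diff[OF V.flux_lim flux_lim[OF adm]] by simp
      fix s assume s: "0 < s" "s \<le> r"
      show "((\<lambda>r. r ^ (N - 1) * w r - flux V r) has_real_derivative
          mu * s ^ (N - 1) * f (V s) - lam * s ^ (N - 1) * f (V s)) (at s)"
        using s r by (intro DERIV_diff V.flux_deriv flux_deriv adm V.V_cont) auto
      have "0 \<le> (mu - lam) * (s ^ (N - 1) * f (V s))"
        using s r mu f_pos f_ge[of "V s"] V.V_pos[of s] by (intro mult_nonneg_nonneg) auto
      then show "0 \<le> mu * s ^ (N - 1) * f (V s) - lam * s ^ (N - 1) * f (V s)"
        by (simp add: algebra_simps)
    qed
    then show ?thesis using r by (simp add: divide_le_eq mult.commute)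
  qed
  have super: "T V r \<le> V r" if r: "0 \<le> r" "r \<le> 1" for r
  proof -
    have "V 1 - T V 1 \<le> V r - T V r"
    proof (rule DERIV_nonpos_imp_decreasing_open[OF r(2), of "\<lambda>r. V r - T V r"])
      fix x assume x: "r < x" "x < 1"
      then show "\<exists>y. ((\<lambda>r. V r - T V r) has_real_derivative y) (at x) \<and> y \<le> 0"
        using r slope[of x]
        by (intro exI[of _ "- w x - - (flux V x / x ^ (N - 1))"] conjI DERIV_diff V.V_deriv T_deriv[OF adm]) auto
    next
      show "continuous_on {r..1} (\<lambda>r. V r - T V r)"
        using r by (intro continuous_intros continuous_on_subset[OF V.V_cont] continuous_on_subset[OF T_cont[OF adm]]) auto
    qed
    then show ?thesis by (simp add: T_1 V.V_1)
  qed
  obtain v where "admissible v" "\<And>r. 0 \<le> r \<Longrightarrow> r \<le> 1 \<Longrightarrow> v r = T v r"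
    "\<And>r. 0 \<le> r \<Longrightarrow> r \<le> 1 \<Longrightarrow> v r \<le> V r"
    using fixed_point[OF adm super] by blast
  then show ?thesis using that radial_solution_fixed_point by blast
qed

end

section \<open>Monotonicity and semi-stability\<close>

text \<open>The radial solution for \<open>lam\<close> constructed below the profile of
  \<open>u'\<close> is a competitor for \<open>u\<close>, so minimality puts \<open>u\<close> below
  it.\<close>

lemma minimal_solution_mono:
  fixes u u' :: "'a::euclidean_space \<Rightarrow> real"
  assumes dim: "DIM('a) \<ge> 3" and f_mono: "mono_on {0..} f" and f_pos: "f 0 > 0"
    and f_cont: "continuous_on {0..} f" and par: "0 < lam" "lam < mu"
    and u: "minimal_solution (ball 0 1) f lam u" and u': "minimal_solution (ball 0 1) f mu u'"
    and x: "x \<in> ball 0 1"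
  shows "u x \<le> u' x"
proof -
  define e :: 'a where "e = (SOME b. b \<in> Basis)"
  have e: "e \<in> Basis" unfolding e_def by (rule someI_ex) (use nonempty_Basis in blast)
  interpret radial_operator "DIM('a)" f lam
    using dim par f_mono f_pos f_cont by unfold_locales auto
  obtain v w where v: "radial_solution DIM('a) f lam v w"
    and le: "\<And>r. 0 \<le> r \<Longrightarrow> r \<le> 1 \<Longrightarrow> v r \<le> u' (r *\<^sub>R e)"
    using radial_solution_below[OF minimal_solution_profile[OF u' e] par(2)] dim by auto
  interpret v: radial_problem "DIM('a)" f lam v w
    using dim par f_mono f_pos v by unfold_locales auto
  have "u x \<le> v (norm x)"
    using u x v.classical_solution_radial[where 'a = 'a, OF f_cont refl]
    unfolding minimal_solution_def by blast
  also have "\<dots> \<le> u' (norm x *\<^sub>R e)" using le[of "norm x"] x by simp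
  also have "\<dots> = u' x" using e x by (intro minimal_solution_radial[OF u']) auto
  finally show ?thesis .
qed

text \<open>The difference \<open>h\<close> of two minimal solutions is a positive supersolution of the linearised
  equation; comparing it with a rescaled eigenfunction at a maximum of their quotient gives a
  pointwise form of the semi-stability inequality.\<close>

lemma minimal_solution_semistable:
  fixes u u' :: "'a::euclidean_space \<Rightarrow> real"
  assumes dim: "DIM('a) \<ge> 3" and f_mono: "mono_on {0..} f" and f_pos: "f 0 > 0"
    and f_cont: "continuous_on {0..} f"
    and tangent: "\<And>s t. s > 0 \<Longrightarrow> t > 0 \<Longrightarrow> f' s * (t - s) \<le> f t - f s"
    and lam: "0 < lam" "lam < mu"
    and u: "minimal_solution (ball 0 1) f lam u" and u': "minimal_solution (ball 0 1) f mu u'"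
    and eig: "dirichlet_eigenvalue (ball (0::'a) 1) \<nu>"
    and r: "0 < r" "r < 1"
    and m: "\<And>x. norm x \<le> r \<Longrightarrow> m \<le> lam * f' (u x)"
  shows "r\<^sup>2 * m \<le> \<nu>"
proof -
  define h where "h x = 1 * u' x + (-1) * u x" for x
  have cl: "classical_solution (ball 0 1) f lam u" "classical_solution (ball 0 1) f mu u'"
    using u u' by (simp_all add: minimal_solution_def)
  then have C2: "C2_on (ball 0 1) u" "C2_on (ball 0 1) u'"
    and pos: "\<And>x. x \<in> ball 0 1 \<Longrightarrow> 0 < u x" "\<And>x. x \<in> ball 0 1 \<Longrightarrow> 0 < u' x"
    and eq: "\<And>x. x \<in> ball 0 1 \<Longrightarrow> - laplacian u x = lam * f (u x)"
      "\<And>x. x \<in> ball 0 1 \<Longrightarrow> - laplacian u' x = mu * f (u' x)"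
    by (simp_all add: classical_solution_def)
  have C2h: "C2_on (ball 0 1) h" unfolding h_def
    by (rule C2_on_linear_combination(1)[OF open_ball C2(2,1)])
  have f_gt: "0 < f t" if "0 < t" for t
    using mono_onD[OF f_mono, of 0 t] f_pos that by simp
  have le: "u x \<le> u' x" if "x \<in> ball 0 1" for x
    by (rule minimal_solution_mono[OF dim f_mono f_pos f_cont lam u u' that])
  have lap_h: "- laplacian h x = mu * f (u' x) - lam * f (u x)" if "x \<in> ball 0 1" for x
    using C2_on_linear_combination(2)[OF open_ball C2(2,1) that, of 1 "-1"] eq[OF that]
    by (simp add: h_def[abs_def])
  \<comment> \<open>Convexity yields the weak inequality; strictness comes from the surplus
    \<open>(mu - lam) * f (u' x)\<close>.\<close>
  have h_super: "lam * f' (u x) * h x < - laplacian h x" if x: "x \<in> ball 0 1" for x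
  proof -
    have "lam * (f' (u x) * (u' x - u x)) \<le> lam * (f (u' x) - f (u x))"
      using tangent[OF pos(1)[OF x] pos(2)[OF x]] lam by (intro mult_left_mono) auto
    moreover have "0 < (mu - lam) * f (u' x)" using lam f_gt pos(2)[OF x] by simp
    ultimately show ?thesis unfolding lap_h[OF x] by (simp add: h_def algebra_simps)
  qed
  \<comment> \<open>A zero of the nonnegative \<open>h\<close> would be an interior minimum, where
    the Laplacian is nonnegative, against the strict inequality \<open>h_super\<close>.\<close>
  have h_pos: "0 < h x" if x: "x \<in> ball 0 1" for x
  proof (rule ccontr)
    assume "\<not> 0 < h x"
    then have h0: "h x = 0" using le[OF x] by (simp add: h_def)
    have "0 \<le> laplacian h x"
      using laplacian_local_min[OF open_ball C2h x] h0 le by (simp add: h_def)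
    then show False using h_super[OF x] h0 by simp
  qed
  \<comment> \<open>Dilation of the ball of radius \<open>r\<close> to the unit ball. As
    \<open>r < 1\<close>, \<open>H\<close> is positive up to the boundary, so quotients by it are
    continuous on the compact ball.\<close>
  define H where "H y = h (r *\<^sub>R y)" for y
  have scale: "r *\<^sub>R y \<in> ball 0 1" if "y \<in> cball 0 1" for y :: 'a
    using that r mult_le_one[of r "norm y"] by (auto simp: mult_less_le_imp_less) (smt (verit) mult_left_le)
  have lin: "linear (\<lambda>y::'a. r *\<^sub>R y)" by (rule linear_scaleR)
  note comp = C2_on_compose_selfadjoint[OF open_ball C2h lin, of "r\<^sup>2"]
  have C2H: "C2_on (ball 0 1) H"
    unfolding H_def by (rule C2_on_subset[OF comp(1)]) (use scale in \<open>auto simp: power2_eq_square\<close>)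
  have lap_H: "laplacian H y = r\<^sup>2 * laplacian h (r *\<^sub>R y)" if "y \<in> ball 0 1" for y
    unfolding H_def by (rule comp(2)) (use scale[of y] that in \<open>auto simp: power2_eq_square\<close>)
  have H_pos: "0 < H y" if "y \<in> cball 0 1" for y
    using h_pos scale[OF that] by (simp add: H_def)
  have H_cont: "continuous_on (cball 0 1) H"
  proof -
    have "continuous_on (ball 0 1) h"
      using C2h unfolding C2_on_def
      by (simp add: continuous_at_imp_continuous_on differentiable_imp_continuous_within)
    then show ?thesis unfolding H_def
      by (rule continuous_on_compose2) (use scale in \<open>auto intro!: continuous_intros\<close>)
  qed
  obtain \<phi> where \<phi>': "continuous_on (closure (ball 0 1)) \<phi>" "C2_on (ball 0 1) \<phi>"
      "\<forall>x\<in>ball 0 1. - laplacian \<phi> x = \<nu> * \<phi> x"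
      "\<forall>x\<in>frontier (ball 0 1). \<phi> x = 0" "\<exists>x\<in>ball (0::'a) 1. \<phi> x \<noteq> 0"
    using eig unfolding dirichlet_eigenvalue_def by blast
  then have \<phi>: "continuous_on (cball 0 1) \<phi>" "C2_on (ball 0 1) \<phi>"
      "\<And>x. x \<in> ball 0 1 \<Longrightarrow> - laplacian \<phi> x = \<nu> * \<phi> x" "\<And>x. norm x = 1 \<Longrightarrow> \<phi> x = 0"
    by simp_all
  obtain x0 where x0: "x0 \<in> ball 0 1" "\<phi> x0 \<noteq> 0" using \<phi>'(5) by blast
  \<comment> \<open>The eigenfunction may change sign; \<sigma> makes the quotient \<open>q\<close>
    positive at \<open>x0\<close>. Its maximum is then positive and lies in the interior, since
    \<open>\<phi>\<close> vanishes on the boundary.\<close>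
  define \<sigma> where "\<sigma> = sgn (\<phi> x0)"
  define q where "q y = \<sigma> * \<phi> y / H y" for y
  have "continuous_on (cball 0 1) q" unfolding q_def
    using H_pos by (intro continuous_intros \<phi>(1) H_cont) (metis less_irrefl)
  then obtain y0 where y0: "y0 \<in> cball 0 1" "\<And>y. y \<in> cball 0 1 \<Longrightarrow> q y \<le> q y0"
    using continuous_attains_sup[of "cball 0 1" q] by auto
  have "0 < q x0" using x0 H_pos[of x0] by (auto simp: q_def \<sigma>_def sgn_if)
  also have "q x0 \<le> q y0" using y0(2)[of x0] x0 by simp
  finally have k: "0 < q y0" .
  then have "\<phi> y0 \<noteq> 0" by (auto simp: q_def)
  then have y0b: "y0 \<in> ball 0 1" using y0(1) \<phi>(4)[of y0] by (cases "norm y0 = 1") auto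
  \<comment> \<open>At the maximum point \<open>y0\<close> of the quotient, \<open>q y0 * H\<close>
    touches \<open>\<sigma> * \<phi>\<close> from above; the difference \<open>F\<close> has an
    interior minimum there.\<close>
  define F where "F y = q y0 * H y + (- \<sigma>) * \<phi> y" for y
  have C2F: "C2_on (ball 0 1) F" unfolding F_def
    by (rule C2_on_linear_combination(1)[OF open_ball C2H \<phi>(2)])
  have F0: "F y0 = 0" using H_pos[OF y0(1)] by (simp add: F_def q_def)
  have "0 \<le> F y" if "y \<in> ball 0 1" for y
    using y0(2)[of y] H_pos[of y] that by (simp add: F_def q_def[of y] divide_le_eq)
  then have "0 \<le> laplacian F y0"
    using laplacian_local_min[OF open_ball C2F y0b] F0 by simp
  also have "laplacian F y0 = q y0 * (r\<^sup>2 * laplacian h (r *\<^sub>R y0)) + \<sigma> * (- laplacian \<phi> y0)"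
    using C2_on_linear_combination(2)[OF open_ball C2H \<phi>(2) y0b, of "q y0" "- \<sigma>"] lap_H[OF y0b]
    by (simp add: F_def[abs_def])
  also have "\<sigma> * (- laplacian \<phi> y0) = \<nu> * (q y0 * H y0)"
    using \<phi>(3)[OF y0b] F0 by (simp add: F_def)
  finally have "q y0 * (r\<^sup>2 * - laplacian h (r *\<^sub>R y0)) \<le> q y0 * (\<nu> * H y0)"
    by (simp add: algebra_simps)
  then have 1: "r\<^sup>2 * - laplacian h (r *\<^sub>R y0) \<le> \<nu> * H y0" using k by (simp only: mult_le_cancel_left_pos)
  have "norm (r *\<^sub>R y0) \<le> r" using y0(1) r by (simp add: mult_left_le)
  from m[OF this] have "m * H y0 \<le> lam * f' (u (r *\<^sub>R y0)) * h (r *\<^sub>R y0)"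
    using H_pos[OF y0(1)] by (simp add: H_def mult_right_mono)
  also have "\<dots> < - laplacian h (r *\<^sub>R y0)" by (rule h_super[OF scale[OF y0(1)]])
  finally have "r\<^sup>2 * (m * H y0) \<le> r\<^sup>2 * - laplacian h (r *\<^sub>R y0)" by (intro mult_left_mono) auto
  with 1 have "(r\<^sup>2 * m) * H y0 \<le> \<nu> * H y0" by (simp add: mult.assoc)
  then show ?thesis using H_pos[OF y0(1)] by (simp only: mult_le_cancel_right_pos)
qed

section \<open>The estimates for the extremal solution\<close>

text \<open>The product equals \<open>2 * (n - 2)\<close> at \<alpha> = 1, so the strict gap permits
  an exponent slightly below 1. With \<alpha> = 1 - \<delta> it is
  \<open>2 * (n - 2) - \<delta> * (n - 4) - \<delta>\<^sup>2\<close>, and \<delta> is chosen using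
  \<open>\<delta>\<^sup>2 \<le> \<delta>\<close>.\<close>

lemma exists_exponent:
  fixes n c :: real
  assumes "n \<ge> 4" "c < 2 * (n - 2)"
  obtains \<alpha> where "0 < \<alpha>" "\<alpha> < 1" "c \<le> (n - 1 - \<alpha>) * (1 + \<alpha>)"
proof -
  define \<delta> where "\<delta> = min (1 / 2) ((2 * (n - 2) - c) / (n - 3))"
  have \<delta>: "0 < \<delta>" "\<delta> \<le> 1 / 2" "\<delta> * (n - 3) \<le> 2 * (n - 2) - c"
    using assms by (auto simp: \<delta>_def min_def field_simps)
  have "\<delta> * \<delta> \<le> \<delta> * 1" using \<delta> by (intro mult_left_mono) auto
  then have "c \<le> (n - 1 - (1 - \<delta>)) * (1 + (1 - \<delta>))" using \<delta>(3) by (simp add: algebra_simps)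
  then show ?thesis using that[of "1 - \<delta>"] \<delta> by simp
qed

lemma superlinear_ratio_bound:
  fixes f :: "real \<Rightarrow> real"
  assumes "filterlim (\<lambda>t. f t / t) at_top at_top"
  obtains M where "\<And>t. 0 < t \<Longrightarrow> f t / t \<le> C \<Longrightarrow> t \<le> M"
proof -
  obtain M where M: "\<And>t. M \<le> t \<Longrightarrow> C < f t / t"
    using assms unfolding filterlim_at_top_dense eventually_at_top_linorder by blast
  show ?thesis by (rule that[of M]) (use M in \<open>meson linorder_not_le order_less_imp_le\<close>)
qed

lemma tangent_line_le:
  fixes f f' :: "real \<Rightarrow> real"
  assumes f': "\<And>t. t \<ge> 0 \<Longrightarrow> (f has_real_derivative f' t) (at t within {0..})"
    and conv: "convex_on {0..} f" and "s > 0" "t \<ge> 0"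
  shows "f' s * (t - s) \<le> f t - f s"
  using convex_on_imp_above_tangent[OF conv _ _ _ f'[of s], of t] assms(3,4) by simp

section \<open>Passage to the extremal solution and the two inequalities\<close>

theorem theorem1p1:
  fixes f f' :: "real \<Rightarrow> real" and lams lam1 :: real and us :: "real ^ 'n \<Rightarrow> ereal"
  assumes dim: "CARD('n) \<ge> 10"
    and f_deriv: "\<And>t. t \<ge> 0 \<Longrightarrow> (f has_real_derivative f' t) (at t within {0..})"
    and f'_cont: "continuous_on {0..} f'"
    and f_mono: "mono_on {0..} f"
    and f_convex: "convex_on {0..} f"
    and f_pos: "f 0 > 0"
    and f_superlinear: "filterlim (\<lambda>t. f t / t) at_top at_top"
    and extremal_par: "extremal_parameter (ball 0 1 :: (real ^ 'n) set) f lams"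
    and extremal_sol: "extremal_solution (ball 0 1) f lams us"
    and unbounded: "\<not> (\<exists>M::real. \<forall>x\<in>ball 0 1. us x \<le> ereal M)"
    and first_eigenvalue: "first_dirichlet_eigenvalue (ball 0 1 :: (real ^ 'n) set) lam1"
  defines "L \<equiv> Limsup (at_right 0) (\<lambda>r. ereal (r\<^sup>2 * f' (real_of_ereal (radial_value us r))))"
  shows "0 < L \<and> L < \<infinity> \<and>
         ereal (2 * (real CARD('n) - 2) / lams) \<le> L \<and> L \<le> ereal (lam1 / lams)"
proof -
  have dims: "DIM(real ^ 'n) = CARD('n)" by simp
  have dim3: "DIM(real ^ 'n) \<ge> 3" using dim dims by linarith
  have lams: "lams > 0" using extremal_par by (simp add: extremal_parameter_def)
  have f_cont: "continuous_on {0..} f"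
    using f_deriv by (intro DERIV_continuous_on[where D = f']) auto
  note tangent = tangent_line_le[OF f_deriv f_convex]
  have f'_mono: "f' s \<le> f' t" if "0 < s" "s \<le> t" for s t
  proof (cases "s = t")
    case False
    have "f' s * (t - s) \<le> f' t * (t - s)"
      using tangent[of s t] tangent[of t s] that by (simp add: algebra_simps)
    then show ?thesis using False that by (simp add: mult_le_cancel_right)
  qed simp
  have f'_nonneg: "0 \<le> f' t" if "0 < t" for t
  proof -
    have "f' t * (0 - t) \<le> 0"
      using tangent[of t 0] mono_onD[OF f_mono, of 0 t] that by simp
    then show ?thesis using that by (simp add: zero_le_mult_iff)
  qed
  obtain U where U: "\<And>lam. 0 < lam \<Longrightarrow> lam < lams \<Longrightarrow> minimal_solution (ball 0 1) f lam (U lam)"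
    and U_lim: "\<And>x. x \<in> ball 0 1 \<Longrightarrow> ((\<lambda>lam. ereal (U lam x)) \<longlongrightarrow> us x) (at_left lams)"
    using extremal_sol unfolding extremal_solution_def by blast
  define e :: "real ^ 'n" where "e = (SOME b. b \<in> Basis)"
  have e: "e \<in> Basis" unfolding e_def by (rule someI_ex) (use nonempty_Basis in blast)
  define V where "V lam r = U lam (r *\<^sub>R e)" for lam r
  define w where "w lam r = - partial e (U lam) (r *\<^sub>R e)" for lam r
  have V_problem: "radial_problem CARD('n) f lam (V lam) (w lam)" if "0 < lam" "lam < lams" for lam
  proof
    show "radial_solution CARD('n) f lam (V lam) (w lam)"
      using minimal_solution_profile[OF U[OF that] e] dim
      by (simp add: V_def[abs_def] w_def[abs_def])
  qed (use dim that f_mono f_pos in auto)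
  have inb: "r *\<^sub>R e \<in> ball 0 1" if "0 \<le> r" "r < 1" for r using that e by simp
  have UV: "U lam x = V lam (norm x)" if "0 < lam" "lam < lams" "x \<in> ball 0 1" for lam x
    unfolding V_def using e that by (intro minimal_solution_radial[OF U]) auto
  \<comment> \<open>The cutoff \<open>lams / 2\<close> keeps the parameter away from 0, so that
    constants can be taken uniform in it.\<close>
  have left: "eventually P (at_left lams)" if "\<And>lam. lams / 2 < lam \<Longrightarrow> lam < lams \<Longrightarrow> P lam" for P
    using that lams by (intro eventually_at_leftI[of "lams / 2"]) auto
  have V_pos: "0 < V lam r" if "0 < lam" "lam < lams" "0 < r" "r < 1" for lam r
    using radial_problem.V_pos[OF V_problem] that by blast
  have bound: "\<exists>M. \<forall>lam. lams / 2 < lam \<longrightarrow> lam < lams \<longrightarrow> V lam r \<le> M" if r: "0 < r" "r < 1" for r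
  proof -
    \<comment> \<open>With this constant, \<open>f_V_bound\<close> reads
      \<open>lam * f (V lam r) * \<kappa> \<le> V lam r\<close>; superlinearity then bounds
      \<open>V lam r\<close> independently of \<open>lam\<close>.\<close>
    define \<kappa> where "\<kappa> = r ^ CARD('n) * (1 - r) / real CARD('n)"
    have \<kappa>: "0 < \<kappa>" using r dim by (simp add: \<kappa>_def)
    obtain M where M: "\<And>t. 0 < t \<Longrightarrow> f t / t \<le> 2 / (lams * \<kappa>) \<Longrightarrow> t \<le> M"
      using superlinear_ratio_bound[OF f_superlinear] by blast
    have "V lam r \<le> M" if lam: "lams / 2 < lam" "lam < lams" for lam
    proof (rule M)
      have lam0: "0 < lam" using lam lams by simp
      show V: "0 < V lam r" by (rule V_pos[OF lam0 lam(2) r])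
      have f_V: "0 \<le> f (V lam r)" using mono_onD[OF f_mono, of 0 "V lam r"] V f_pos by simp
      have "lams / 2 * (f (V lam r) * \<kappa>) \<le> lam * (f (V lam r) * \<kappa>)"
        using lam f_V \<kappa> by (intro mult_right_mono) auto
      also have "\<dots> \<le> V lam r"
        using radial_problem.f_V_bound[OF V_problem[OF lam0 lam(2)] r] by (simp add: \<kappa>_def mult.assoc)
      finally show "f (V lam r) / V lam r \<le> 2 / (lams * \<kappa>)"
        using V \<kappa> lams by (simp add: field_simps)
    qed
    then show ?thesis by blast
  qed
  \<comment> \<open>By \<open>bound\<close> the limit is finite for \<open>0 < r < 1\<close>, so its
    real part loses nothing there; an infinite value can occur only at the origin.\<close>
  define S where "S r = real_of_ereal (us (r *\<^sub>R e))" for r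
  have V_mono: "V lam r \<le> V mu r" if "0 < lam" "lam \<le> mu" "mu < lams" "0 \<le> r" "r < 1" for lam mu r
  proof (cases "lam = mu")
    case False
    then show ?thesis unfolding V_def
      by (intro minimal_solution_mono[OF dim3 f_mono f_pos f_cont _ _ U U inb]) (use that in auto)
  qed simp
  have S: "us (r *\<^sub>R e) = ereal (S r)" if r: "0 < r" "r < 1" for r
  proof -
    obtain M where M: "\<And>lam. lams / 2 < lam \<Longrightarrow> lam < lams \<Longrightarrow> V lam r \<le> M"
      using bound[OF r] by blast
    have lim: "((\<lambda>lam. ereal (V lam r)) \<longlongrightarrow> us (r *\<^sub>R e)) (at_left lams)"
      unfolding V_def using U_lim inb r by simp
    have "us (r *\<^sub>R e) \<le> ereal M"
      by (rule tendsto_upperbound[OF lim left]) (use M in auto)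
    moreover have "ereal 0 \<le> us (r *\<^sub>R e)"
    proof (rule tendsto_lowerbound[OF lim left])
      fix lam assume "lams / 2 < lam" "lam < lams"
      then show "ereal 0 \<le> ereal (V lam r)" using V_pos[of lam r] r lams by simp
    qed simp
    ultimately have "\<bar>us (r *\<^sub>R e)\<bar> \<noteq> \<infinity>" by (cases "us (r *\<^sub>R e)") auto
    then show ?thesis by (simp add: S_def ereal_real)
  qed
  have V_lim: "((\<lambda>lam. V lam r) \<longlongrightarrow> S r) (at_left lams)" if r: "0 < r" "r < 1" for r
    using U_lim[of "r *\<^sub>R e"] inb[of r] r S[OF r] by (simp add: V_def[symmetric])
  have V_le_S: "V lam r \<le> S r" if "0 < lam" "lam < lams" "0 < r" "r < 1" for lam r
  proof (rule tendsto_lowerbound[OF V_lim[OF that(3,4)]])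
    show "\<forall>\<^sub>F mu in at_left lams. V lam r \<le> V mu r"
      using that V_mono by (intro eventually_at_leftI[of lam]) auto
  qed simp
  \<comment> \<open>The definite description in \<open>radial_value\<close> requires one common
    value on the sphere. Symmetry of each \<open>U lam\<close> passes to the limit, and the sphere
    contains the point \<open>r *\<^sub>R e\<close>.\<close>
  have radial: "radial_value us r = ereal (S r)" if r: "0 < r" "r < 1" for r
  proof -
    have eq: "us x = us (r *\<^sub>R e)" if "norm x = r" for x
    proof (rule tendsto_unique[OF _ U_lim])
      have "eventually (\<lambda>lam. ereal (U lam (r *\<^sub>R e)) = ereal (U lam x)) (at_left lams)"
        using that r lams UV[of _ x] by (intro left) (simp add: V_def)
      then show "((\<lambda>lam. ereal (U lam x)) \<longlongrightarrow> us (r *\<^sub>R e)) (at_left lams)"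
        by (rule Lim_transform_eventually[OF U_lim[OF inb], rotated 2]) (use r in auto)
    qed (use that r in auto)
    have n: "norm (r *\<^sub>R e) = r" using e r by simp
    show ?thesis unfolding radial_value_def S[OF r, symmetric]
    proof (rule the_equality)
      show "\<forall>x. norm x = r \<longrightarrow> us x = us (r *\<^sub>R e)" using eq by blast
      show "s = us (r *\<^sub>R e)" if "\<forall>x. norm x = r \<longrightarrow> us x = s" for s using that n by blast
    qed
  qed
  have L_eq: "L = Limsup (at_right 0) (\<lambda>r. ereal (r\<^sup>2 * f' (S r)))"
    unfolding L_def
    by (rule Limsup_eq) (auto simp: radial intro!: eventually_at_rightI[of 0 1])
  have eig: "dirichlet_eigenvalue (ball 0 1 :: (real ^ 'n) set) lam1"
    using first_eigenvalue by (simp add: first_dirichlet_eigenvalue_def)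
  have upper: "lams * (r\<^sup>2 * f' (S r)) \<le> lam1" if r: "0 < r" "r < 1" for r
  proof (rule tendsto_upperbound)
    have S_pos: "0 < S r" using V_pos[of "lams / 2" r] V_le_S[of "lams / 2" r] r lams by simp
    then have "isCont f' (S r)"
      using f'_cont continuous_on_interior[of "{0..}" f' "S r"] by simp
    then have "((\<lambda>lam. f' (V lam r)) \<longlongrightarrow> f' (S r)) (at_left lams)"
      by (rule isCont_tendsto_compose[OF _ V_lim[OF r]])
    then show "((\<lambda>lam. lam * (r\<^sup>2 * f' (V lam r))) \<longlongrightarrow> lams * (r\<^sup>2 * f' (S r))) (at_left lams)"
      by (intro tendsto_intros)
    show "\<forall>\<^sub>F lam in at_left lams. lam * (r\<^sup>2 * f' (V lam r)) \<le> lam1"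
    proof (rule left)
      fix lam assume lam: "lams / 2 < lam" "lam < lams"
      then have lam0: "0 < lam" using lams by simp
      \<comment> \<open>The semi-stability lemma needs a second minimal solution with a larger
        parameter; the midpoint stays below \<open>lams\<close>.\<close>
      define mu where "mu = (lam + lams) / 2"
      have mu: "lam < mu" "mu < lams" "0 < mu" using lam lam0 by (auto simp: mu_def)
      have "r\<^sup>2 * (lam * f' (V lam r)) \<le> lam1"
      proof (rule minimal_solution_semistable[OF dim3 f_mono f_pos f_cont _ lam0 mu(1) U[OF lam0 lam(2)] U[OF mu(3,2)] eig r])
        \<comment> \<open>Profiles decrease and \<open>f'\<close> increases, so on the ball of
          radius \<open>r\<close> the coefficient is smallest on its boundary sphere.\<close>
        fix x :: "real ^ 'n" assume x: "norm x \<le> r"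
        then have "V lam r \<le> V lam (norm x)"
          using radial_problem.V_antimono[OF V_problem[OF lam0 lam(2)], of "norm x" r] r by simp
        then have "f' (V lam r) \<le> f' (V lam (norm x))"
          using V_pos[OF lam0 lam(2) r] by (intro f'_mono) auto
        then show "lam * f' (V lam r) \<le> lam * f' (U lam x)"
          using UV[OF lam0 lam(2), of x] x r lam0 by (simp add: mult_left_mono)
      qed (use tangent in auto)
      then show "lam * (r\<^sup>2 * f' (V lam r)) \<le> lam1" by (simp add: mult_ac)
    qed
  qed simp
  have L_upper: "L \<le> ereal (lam1 / lams)"
    unfolding L_eq
  proof (rule Limsup_bounded)
    show "\<forall>\<^sub>F r in at_right 0. ereal (r\<^sup>2 * f' (S r)) \<le> ereal (lam1 / lams)"
      by (rule eventually_at_rightI[of 0 1]) (use upper lams in \<open>auto simp: le_divide_eq mult.commute\<close>)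
  qed
  have L_lower: "ereal (2 * (real CARD('n) - 2) / lams) \<le> L"
  proof (rule ccontr)
    assume "\<not> ereal (2 * (real CARD('n) - 2) / lams) \<le> L"
    then have "L < ereal (2 * (real CARD('n) - 2) / lams)" by simp
    \<comment> \<open>The real number \<open>c\<close> strictly below the critical constant leaves
      the room needed for an exponent \<alpha> < 1.\<close>
    then obtain c where c: "L < ereal c" "c < 2 * (real CARD('n) - 2) / lams"
      using ereal_dense2 by (metis ereal_less_ereal_Ex less_ereal.simps(1))
    have "eventually (\<lambda>r. ereal (r\<^sup>2 * f' (S r)) < ereal c) (at_right 0)"
      using Limsup_lessD[OF c(1)[unfolded L_eq]] .
    then obtain b where b: "0 < b" "\<And>r. 0 < r \<Longrightarrow> r < b \<Longrightarrow> r\<^sup>2 * f' (S r) < c"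
      by (auto simp: eventually_at_right[OF zero_less_one])
    obtain \<alpha> where \<alpha>: "0 < \<alpha>" "\<alpha> < 1" "lams * c \<le> (real CARD('n) - 1 - \<alpha>) * (1 + \<alpha>)"
      using exists_exponent[of "real CARD('n)" "lams * c"] c(2) dim lams
      by (auto simp: less_divide_eq mult.commute)
    define R where "R = min b 1 / 2"
    have R: "0 < R" "R < 1" "R < b" using b(1) by (auto simp: R_def min_def)
    obtain M where M: "\<And>lam. lams / 2 < lam \<Longrightarrow> lam < lams \<Longrightarrow> V lam R \<le> M"
      using bound[OF R(1,2)] by blast
    define K where "K = 1 + 1 / ((1 - \<alpha>) * (R ^ (CARD('n) - 1) * (1 - R)))"
    have K: "0 \<le> K" using \<alpha> R by (simp add: K_def)
    have V_0: "V lam 0 \<le> M * K" if lam: "lams / 2 < lam" "lam < lams" for lam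
    proof -
      have lam0: "0 < lam" using lam lams by simp
      have "V lam 0 \<le> V lam R * K" unfolding K_def
      proof (rule radial_problem.V_0_bound[OF V_problem[OF lam0 lam(2)] f_deriv \<alpha>(1,2) R(1,2)])
        fix r assume r: "0 < r" "r \<le> R"
        have pos: "0 < V lam r" and le: "V lam r \<le> S r"
          using V_pos[OF lam0 lam(2), of r] V_le_S[OF lam0 lam(2), of r] r R by auto
        \<comment> \<open>The bound known for the limit profile \<open>S\<close> passes down to
          every \<open>V lam\<close>, since \<open>f'\<close> is nonnegative and increasing. Hence
          \<alpha> and \<open>R\<close> serve all parameters at once.\<close>
        have "lam * f' (V lam r) \<le> lams * f' (S r)"
          using lam lam0 f'_mono[OF pos le] f'_nonneg[OF pos] by (intro mult_mono) auto
        then have "r\<^sup>2 * (lam * f' (V lam r)) \<le> r\<^sup>2 * (lams * f' (S r))" by (intro mult_left_mono) auto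
        also have "\<dots> = lams * (r\<^sup>2 * f' (S r))" by simp
        also have "\<dots> \<le> lams * c" using b(2)[of r] r R lams by (intro mult_left_mono) auto
        finally show "r\<^sup>2 * (lam * f' (V lam r)) \<le> (real CARD('n) - 1 - \<alpha>) * (1 + \<alpha>)"
          using \<alpha>(3) by simp
      qed auto
      also have "\<dots> \<le> M * K" using M[OF lam] K by (rule mult_right_mono)
      finally show ?thesis .
    qed
    \<comment> \<open>Each profile is largest at the origin, so the uniform bound on
      \<open>V lam 0\<close> bounds the limit on the whole ball and contradicts
      \<open>unbounded\<close>.\<close>
    have "us x \<le> ereal (M * K)" if x: "x \<in> ball 0 1" for x
    proof (rule tendsto_upperbound[OF U_lim[OF x] left])
      fix lam assume lam: "lams / 2 < lam" "lam < lams"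
      then have lam0: "0 < lam" using lams by simp
      have "U lam x = V lam (norm x)" by (rule UV[OF lam0 lam(2) x])
      also have "\<dots> \<le> V lam 0"
        using radial_problem.V_antimono[OF V_problem[OF lam0 lam(2)], of 0 "norm x"] x by simp
      also have "\<dots> \<le> M * K" by (rule V_0[OF lam])
      finally show "ereal (U lam x) \<le> ereal (M * K)" by simp
    qed simp
    then show False using unbounded by blast
  qed
  have "0 < ereal (2 * (real CARD('n) - 2) / lams)" using dim lams by simp
  then have "0 < L" using L_lower by (rule less_le_trans)
  moreover have "L < \<infinity>" using L_upper by (rule le_less_trans) simp
  ultimately show ?thesis using L_lower L_upper by blast
qed

end
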